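(* Let $n\ge 1$, let $k$ be a field, $S=k[x_1,\ldots,x_n]$, and let $M$ be an arbitrary monomial ideal of $S$. Then for every monomial $l$ of $S$, \[\operatorname{b}_{n,l}(S/M)=\begin{cases}1, & \text{if there is } D\in\mathscr{D}_M \text{ with } l=\operatorname{lcm}(D),\\ 0, & \text{otherwise.}\end{cases}\]
   Context: $\operatorname{b}_{i,l}(S/M)$ denotes the multigraded Betti number of $S/M$ in homological degree $i$ and multidegree the monomial $l$, i.e. the number of basis elements of multidegree $l$ in the $i$-th free module of a minimal multigraded free resolution of $S/M$. Let $G$ be the minimal generating set (of monomials) of $M$. For a set $L$ of monomials, $m\in L$ is dominant (in $L$) if there is a variable $x$ such that for all $m'\in L\setminus\{m\}$ the exponent of $x$ in $m$ is strictly larger than that in $m'$; $L$ is a dominant set if each of its elements is dominant in $L$. For monomials $l=x_1^{\alpha_1}\cdots x_n^{\alpha_n}$, $l'=x_1^{\beta_1}\cdots x_n^{\beta_n}$, $l$ strongly divides $l'$ if $\alpha_i<\beta_i$ whenever $\alpha_i\neq 0$. Finally, $\mathscr{D}_M=\{D\subseteq G : D$ is a dominant set of cardinality $n$ such that no element of $G$ strongly divides $\operatorname{lcm}(D)\}$. *)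

theory Defs
  imports
    "HOL-Library.Poly_Mapping"
    "HOL-Library.Cardinality"
    "Jordan_Normal_Form.Matrix_Kernel"
begin

text \<open>
  The variables are the elements of a finite type \<open>'n\<close>, so that \<open>n = CARD('n) \<ge> 1\<close>. A monomial is
  given by its exponent vector (so the product of monomials is \<open>+\<close>, and the monomial 1 is \<open>0\<close>),
  and \<open>S = k[x\<^sub>1, ..., x\<^sub>n]\<close> is the monoid algebra of the monomials over \<open>k\<close>.
\<close>

type_synonym 'n mon = "'n \<Rightarrow>\<^sub>0 nat"

type_synonym ('n, 'k) mpoly = "'n mon \<Rightarrow>\<^sub>0 'k"

definition mono_of :: "'n mon \<Rightarrow> ('n, 'k::field) mpoly" where
  "mono_of a = Poly_Mapping.single a 1"

text \<open>The ideals of \<open>S\<close> are the submodules of \<open>S\<close> as a module over itself.\<close>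

definition ideal_gen :: "('n, 'k::field) mpoly set \<Rightarrow> ('n, 'k) mpoly set" where
  "ideal_gen X = Modules.module.span (*) X"

definition monomial_ideal :: "('n, 'k::field) mpoly set \<Rightarrow> bool" where
  "monomial_ideal M \<longleftrightarrow> (\<exists>A. M = ideal_gen (mono_of ` A))"

definition min_gens :: "('n, 'k::field) mpoly set \<Rightarrow> 'n mon set" where
  "min_gens M = (THE G. ideal_gen (mono_of ` G) = M \<and> (\<forall>H. H \<subset> G \<longrightarrow> ideal_gen (mono_of ` H) \<noteq> M))"

text \<open>The maximal ideal generated by the variables.\<close>

definition max_ideal :: "('n, 'k::field) mpoly set" where
  "max_ideal = ideal_gen (range (\<lambda>x. mono_of (Poly_Mapping.single x 1)))"

subsection \<open>Minimal multigraded free resolutions\<close>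

text \<open>
  A list \<open>ds\<close> of monomials stands for the multigraded free module \<open>S\<^sup>r\<close>, \<open>r = length ds\<close>, whose
  basis element number \<open>j\<close> has multidegree \<open>ds ! j\<close>; its elements are those of \<open>carrier_vec r\<close>.
  A homomorphism of multidegree 0 from the module of \<open>es\<close> to that of \<open>ds\<close> is a matrix whose entry
  in place \<open>(i, j)\<close> is a scalar multiple of the monomial \<open>es ! j / ds ! i\<close>, and zero if
  \<open>ds ! i\<close> does not divide \<open>es ! j\<close>.
\<close>

definition graded_mat :: "'n mon list \<Rightarrow> 'n mon list \<Rightarrow> ('n, 'k::field) mpoly mat \<Rightarrow> bool" where
  "graded_mat ds es A \<longleftrightarrow>
     A \<in> carrier_mat (length ds) (length es) \<and>
     (\<forall>i<length ds. \<forall>j<length es. \<forall>a\<in>Poly_Mapping.keys (A $$ (i, j)). a + ds ! i = es ! j)"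

definition mat_image :: "('n, 'k::field) mpoly mat \<Rightarrow> ('n, 'k) mpoly vec set" where
  "mat_image A = (\<lambda>v. A *\<^sub>v v) ` carrier_vec (dim_col A)"

text \<open>
  A resolution \<open>... \<rightarrow> F\<^sub>2 \<rightarrow> F\<^sub>1 \<rightarrow> F\<^sub>0 \<rightarrow> S/M \<rightarrow> 0\<close>: the basis of \<open>F\<^sub>i\<close> has the multidegrees \<open>ds i\<close>,
  the map from \<open>F\<^sub>i\<^sub>+\<^sub>1\<close> to \<open>F\<^sub>i\<close> is \<open>d i\<close>, and the augmentation from \<open>F\<^sub>0\<close> to \<open>S/M\<close> sends basis element
  number \<open>j\<close> to the class of \<open>e $ j\<close> modulo \<open>M\<close>. Membership in \<open>M\<close> thus plays the role of being
  zero in \<open>S/M\<close>. Homogeneous classes of \<open>S/M\<close> have homogeneous representatives, since \<open>M\<close> is a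
  monomial ideal. Note that \<open>F\<^sub>0\<close> is not required to be \<open>S\<close>; it is 0 in the minimal resolution if
  \<open>M = S\<close>.
\<close>

definition graded_free_resolution ::
  "('n, 'k::field) mpoly set \<Rightarrow> (nat \<Rightarrow> 'n mon list) \<Rightarrow> ('n, 'k) mpoly vec \<Rightarrow>
    (nat \<Rightarrow> ('n, 'k) mpoly mat) \<Rightarrow> bool" where
  "graded_free_resolution M ds e d \<longleftrightarrow>
     e \<in> carrier_vec (length (ds 0)) \<and>
     (\<forall>j<length (ds 0). \<forall>a\<in>Poly_Mapping.keys (e $ j). a = ds 0 ! j) \<and>
     (\<forall>i. graded_mat (ds i) (ds (Suc i)) (d i)) \<and>
     (\<forall>p. \<exists>v\<in>carrier_vec (length (ds 0)). p - scalar_prod e v \<in> M) \<and>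
     mat_image (d 0) = {v \<in> carrier_vec (length (ds 0)). scalar_prod e v \<in> M} \<and>
     (\<forall>i. mat_image (d (Suc i)) = mat_kernel (d i))"

text \<open>Minimality says that the image of each map \<open>F\<^sub>i\<^sub>+\<^sub>1 \<rightarrow> F\<^sub>i\<close> lies in the maximal ideal times \<open>F\<^sub>i\<close>.\<close>

definition minimal_graded_free_resolution ::
  "('n, 'k::field) mpoly set \<Rightarrow> (nat \<Rightarrow> 'n mon list) \<Rightarrow> ('n, 'k) mpoly vec \<Rightarrow>
    (nat \<Rightarrow> ('n, 'k) mpoly mat) \<Rightarrow> bool" where
  "minimal_graded_free_resolution M ds e d \<longleftrightarrow>
     graded_free_resolution M ds e d \<and>
     (\<forall>i. \<forall>v\<in>mat_image (d i). \<forall>j<length (ds i). v $ j \<in> max_ideal)"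

definition betti :: "('n, 'k::field) mpoly set \<Rightarrow> nat \<Rightarrow> 'n mon \<Rightarrow> nat" where
  "betti M i l =
     (THE b. \<exists>ds e d. minimal_graded_free_resolution M ds e d \<and> b = count_list (ds i) l)"

subsection \<open>Dominant sets\<close>

definition dominant :: "'n mon set \<Rightarrow> 'n mon \<Rightarrow> bool" where
  "dominant L m \<longleftrightarrow>
     m \<in> L \<and> (\<exists>x. \<forall>m'\<in>L - {m}. Poly_Mapping.lookup m' x < Poly_Mapping.lookup m x)"

definition dominant_set :: "'n mon set \<Rightarrow> bool" where
  "dominant_set L \<longleftrightarrow> (\<forall>m\<in>L. dominant L m)"

definition strongly_divides :: "'n mon \<Rightarrow> 'n mon \<Rightarrow> bool" where
  "strongly_divides m m' \<longleftrightarrow>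
     (\<forall>x. Poly_Mapping.lookup m x \<noteq> 0 \<longrightarrow> Poly_Mapping.lookup m x < Poly_Mapping.lookup m' x)"

text \<open>Only meant for finite \<open>D\<close>; the element 0 makes the lcm of the empty set equal to 1.\<close>

definition lcm_mon :: "'n::finite mon set \<Rightarrow> 'n mon" where
  "lcm_mon D = Abs_poly_mapping (\<lambda>x. Max (insert 0 ((\<lambda>m. Poly_Mapping.lookup m x) ` D)))"

lemma lookup_lcm_mon:
  "Poly_Mapping.lookup (lcm_mon D) x = Max (insert 0 ((\<lambda>m. Poly_Mapping.lookup m x) ` D))"
  unfolding lcm_mon_def by (subst Abs_poly_mapping_inverse) auto

definition dominant_family :: "('n::finite, 'k::field) mpoly set \<Rightarrow> 'n mon set set" where
  "dominant_family M =
     {D. D \<subseteq> min_gens M \<and> dominant_set D \<and> card D = CARD('n) \<and>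
         (\<forall>m\<in>min_gens M. \<not> strongly_divides m (lcm_mon D))}"

end

theory Submission
  imports Defs "HOL-Library.Function_Algebras"
begin

text \<open>
  Write \<open>1\<close> for the exponent vector \<open>(1, ..., 1)\<close> and \<open>\<epsilon>\<^sub>x\<close> for the exponent vector of the variable \<open>x\<close>.
  The Betti number in homological degree \<open>n\<close> and multidegree \<open>l\<close> is the dimension of the part of
  degree \<open>l\<close> of \<open>Tor\<^sub>n(S/M, k)\<close>, and this is the socle of \<open>S/M\<close> in degree \<open>l - 1\<close>. It is at most
  one-dimensional, and it is nonzero exactly if \<open>l\<close> is positive in all variables, the monomial with
  exponent \<open>l - 1\<close> is not in \<open>M\<close>, and its product with any variable is in \<open>M\<close>. These degrees \<open>l\<close> are
  the lcms of the sets in \<open>\<D>\<^sub>M\<close>: if \<open>l\<close> is such a degree, each variable \<open>x\<close> gives a minimal generator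
  dividing \<open>l - 1 + \<epsilon>\<^sub>x\<close>, which agrees with \<open>l\<close> in \<open>x\<close> and is smaller in all other variables, so that
  these \<open>n\<close> generators form a dominant set with lcm \<open>l\<close>; and a monomial strongly divides \<open>l\<close> exactly if
  it divides \<open>l - 1\<close>. The converse reverses this argument (\<open>dominant_family_if_socle_deg\<close>,
  \<open>socle_deg_if_dominant_family\<close>).

  The identification of \<open>Tor\<^sub>n\<close> adds one variable at a time, which avoids the signs of the Koszul
  complex. Let \<open>F\<close> be a minimal resolution. In a fixed degree, the free modules are spaces of
  coefficient vectors and the differentials are matrices of scalars. For a set \<open>P\<close> of variables, the
  part of degree \<open>l\<close> of the reduction of \<open>F\<close> modulo the variables in \<open>P\<close> has the complex \<open>C(P, l)\<close> of
  vectors supported on those basis elements whose degree divides \<open>l\<close> and agrees with \<open>l\<close> on \<open>P\<close>. For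
  \<open>q \<notin> P\<close> and \<open>l\<close> positive at \<open>q\<close> there is an exact sequence of complexes
  \<open>0 \<rightarrow> C(P, l - \<epsilon>\<^sub>q) \<rightarrow> C(P, l) \<rightarrow> C(P \<union> {q}, l) \<rightarrow> 0\<close>. Its connecting map embeds the homology
  of \<open>C(P \<union> {q}, l)\<close> in homological degree \<open>|P| + 1\<close> into that of \<open>C(P, l - \<epsilon>\<^sub>q)\<close> in degree \<open>|P|\<close>, as
  the kernel of the map to the homology of \<open>C(P, l)\<close>. This gives by induction that the homology of
  \<open>C(P, l)\<close> vanishes above degree \<open>|P|\<close> and that in degree \<open>|P|\<close> it is a socle with respect to the
  variables of \<open>P\<close> (\<open>homology_strand\<close>). The induction starts with the exactness of \<open>F\<close>. If \<open>P\<close>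
  contains all variables, the differential is zero because \<open>F\<close> is minimal, and the homology counts the
  basis elements of degree \<open>l\<close> (\<open>rank_top_strand\<close>).

  Since the Betti number is given by a definite description, a minimal resolution has to exist. A
  graded submodule of a free module is a monotone family of spaces of coefficient vectors, one for
  each degree. By Dickson's lemma it has a finite set of homogeneous generators
  (\<open>finitely_generated\<close>); one with the least number of elements has all its relations in the maximal
  ideal times the free module (\<open>minimal_cover\<close>), and iterating this produces a minimal resolution
  (\<open>minimal_resolution_exists\<close>).
\<close>

abbreviation lookup :: "('a \<Rightarrow>\<^sub>0 'b::zero) \<Rightarrow> 'a \<Rightarrow> 'b" where
  "lookup \<equiv> Poly_Mapping.lookup"

abbreviation keys :: "('a \<Rightarrow>\<^sub>0 'b::zero) \<Rightarrow> 'a set" where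
  "keys \<equiv> Poly_Mapping.keys"

section \<open>Socle degrees\<close>

definition lower :: "'n set \<Rightarrow> ('n \<Rightarrow> nat) \<Rightarrow> 'n \<Rightarrow> nat" where
  "lower P l = (\<lambda>x. if x \<in> P then l x - 1 else l x)"

text \<open>
  For the set \<open>U\<close> of exponents of the monomials in \<open>M\<close>, this says that the monomial with exponent
  \<open>lower P l\<close> represents a nonzero element of \<open>S/M\<close> that is annihilated by the variables in \<open>P\<close>:
  multiplying it by \<open>x \<in> P\<close> gives the exponent \<open>lower (P - {x}) l\<close>.
\<close>
definition socle_deg :: "('n \<Rightarrow> nat) set \<Rightarrow> 'n set \<Rightarrow> ('n \<Rightarrow> nat) \<Rightarrow> bool" where
  "socle_deg U P l \<longleftrightarrow>
     (\<forall>x\<in>P. 0 < l x) \<and> lower P l \<notin> U \<and> (\<forall>x\<in>P. lower (P - {x}) l \<in> U)"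

text \<open>
  The exponents \<open>lower (insert q P) l\<close> and \<open>lower P l\<close> differ by the variable \<open>q\<close>. If the first
  represents a nonzero element annihilated by the variables in \<open>P\<close>, then the second represents an
  element annihilated by \<open>P\<close> as well; so it is zero, as annihilation by \<open>q\<close> demands, exactly if \<open>l\<close> is not
  a socle degree for \<open>P\<close>.
\<close>
lemma socle_deg_insert:
  assumes up: "\<And>a b. a \<in> U \<Longrightarrow> a \<le> b \<Longrightarrow> b \<in> U" and q: "q \<notin> P" "0 < l q"
  shows "socle_deg U (insert q P) l \<longleftrightarrow> socle_deg U P (l(q := l q - 1)) \<and> \<not> socle_deg U P l"
proof -
  let ?a = "l(q := l q - 1)"
  have 1: "lower (insert q P) l = lower P ?a"
    using q by (auto simp: lower_def fun_eq_iff)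
  have 2: "lower (insert q P - {q}) l = lower P l"
    using q by (auto simp: lower_def fun_eq_iff)
  have 3: "lower (insert q P - {x}) l = lower (P - {x}) ?a" if "x \<in> P" for x
  proof
    fix y
    have "x \<noteq> q" using that q by auto
    then show "lower (insert q P - {x}) l y = lower (P - {x}) ?a y"
      using q by (cases "y = q") (simp_all add: lower_def)
  qed
  have 4: "lower (P - {x}) l \<in> U" if "lower (P - {x}) ?a \<in> U" for x
    using that by (rule up) (auto simp: lower_def le_fun_def)
  have 5: "(\<forall>x\<in>P. 0 < ?a x) \<longleftrightarrow> (\<forall>x\<in>P. 0 < l x)" using q by auto
  have "socle_deg U (insert q P) l \<longleftrightarrow> (\<forall>x\<in>P. 0 < l x) \<and> lower P ?a \<notin> U
      \<and> lower P l \<in> U \<and> (\<forall>x\<in>P. lower (P - {x}) ?a \<in> U)"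
    unfolding socle_deg_def 1 ball_simps 2 using q(2) 3 by auto
  moreover have "socle_deg U P ?a \<longleftrightarrow> (\<forall>x\<in>P. 0 < l x) \<and> lower P ?a \<notin> U
      \<and> (\<forall>x\<in>P. lower (P - {x}) ?a \<in> U)"
    unfolding socle_deg_def 5 by auto
  ultimately show ?thesis
    using 4 unfolding socle_deg_def[of U P l] by blast
qed

section \<open>Homology of the strands of a resolution\<close>

text \<open>
  Vectors with coefficients in the field, indexed by the basis elements \<open>j < r\<close> with degrees \<open>deg j\<close>
  of a graded free module. For empty \<open>P\<close> this is the part of degree \<open>l\<close> of the module: \<open>v j\<close> is the
  coefficient of the one monomial multiple of basis element \<open>j\<close> that has degree \<open>l\<close>. In general it is
  the part of degree \<open>l\<close> of the module modulo the variables in \<open>P\<close>. Vectors are functions on all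
  natural numbers that vanish outside the index range, so that vectors of different lengths share a
  type.
\<close>
definition strand ::
  "nat \<Rightarrow> (nat \<Rightarrow> 'n \<Rightarrow> nat) \<Rightarrow> 'n set \<Rightarrow> ('n \<Rightarrow> nat) \<Rightarrow> (nat \<Rightarrow> 'k::zero) set" where
  "strand r deg P l = {v. \<forall>j. v j \<noteq> 0 \<longrightarrow> j < r \<and> deg j \<le> l \<and> (\<forall>x\<in>P. deg j x = l x)}"

definition coeff_map :: "nat \<Rightarrow> nat \<Rightarrow> (nat \<Rightarrow> nat \<Rightarrow> 'k::comm_ring) \<Rightarrow> (nat \<Rightarrow> 'k) \<Rightarrow> nat \<Rightarrow> 'k" where
  "coeff_map r s D v = (\<lambda>i. if i < r then (\<Sum>j<s. D i j * v j) else 0)"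

text \<open>
  A multigraded free resolution of a cyclic module whose part of degree \<open>l\<close> is \<open>k\<close> if \<open>l \<notin> U\<close> and \<open>0\<close>
  otherwise, seen degree by degree: \<open>D p\<close> holds the coefficients of the map from homological degree
  \<open>Suc p\<close> to \<open>p\<close>, and \<open>e\<close> those of the augmentation. Degrees are functions, because changing one
  exponent is then a function update.
\<close>
locale coefficient_resolution =
  fixes r :: "nat \<Rightarrow> nat"
    and deg :: "nat \<Rightarrow> nat \<Rightarrow> 'n \<Rightarrow> nat"
    and D :: "nat \<Rightarrow> nat \<Rightarrow> nat \<Rightarrow> 'k::field"
    and e :: "nat \<Rightarrow> 'k"
    and U :: "('n \<Rightarrow> nat) set"
  assumes D_graded: "D p i j \<noteq> 0 \<Longrightarrow> i < r p \<Longrightarrow> j < r (Suc p) \<Longrightarrow> deg p i \<le> deg (Suc p) j"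
    and U_up: "a \<in> U \<Longrightarrow> a \<le> b \<Longrightarrow> b \<in> U"
    and aug_onto: "l \<notin> U \<Longrightarrow> \<exists>v\<in>strand (r 0) (deg 0) {} l. (\<Sum>j<r 0. e j * v j) \<noteq> 0"
    and exact_aug: "v \<in> strand (r 0) (deg 0) {} l \<Longrightarrow>
      l \<in> U \<or> (\<Sum>j<r 0. e j * v j) = 0 \<longleftrightarrow>
      v \<in> coeff_map (r 0) (r 1) (D 0) ` strand (r 1) (deg 1) {} l"
    and exact: "v \<in> strand (r (Suc p)) (deg (Suc p)) {} l \<Longrightarrow>
      coeff_map (r p) (r (Suc p)) (D p) v = 0 \<longleftrightarrow>
      v \<in> coeff_map (r (Suc p)) (r (Suc (Suc p))) (D (Suc p)) `
        strand (r (Suc (Suc p))) (deg (Suc (Suc p))) {} l"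
begin

abbreviation C :: "nat \<Rightarrow> 'n set \<Rightarrow> ('n \<Rightarrow> nat) \<Rightarrow> (nat \<Rightarrow> 'k) set" where
  "C p \<equiv> strand (r p) (deg p)"

abbreviation app :: "nat \<Rightarrow> (nat \<Rightarrow> 'k) \<Rightarrow> nat \<Rightarrow> 'k" where
  "app p \<equiv> coeff_map (r p) (r (Suc p)) (D p)"

text \<open>Reduction modulo the variables in \<open>P\<close>, in degree \<open>l\<close>.\<close>
definition proj :: "nat \<Rightarrow> 'n set \<Rightarrow> ('n \<Rightarrow> nat) \<Rightarrow> (nat \<Rightarrow> 'k) \<Rightarrow> nat \<Rightarrow> 'k" where
  "proj p P l v = (\<lambda>i. if \<forall>x\<in>P. deg p i x = l x then v i else 0)"

text \<open>The differential of the reduced complex; it depends only on the values of \<open>l\<close> on \<open>P\<close>.\<close>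
definition bd :: "nat \<Rightarrow> 'n set \<Rightarrow> ('n \<Rightarrow> nat) \<Rightarrow> (nat \<Rightarrow> 'k) \<Rightarrow> nat \<Rightarrow> 'k" where
  "bd p P l v = proj p P l (app p v)"

lemma C_add: "v \<in> C p P l \<Longrightarrow> w \<in> C p P l \<Longrightarrow> v + w \<in> C p P l"
  unfolding strand_def by (auto, (metis add_0)+)

lemma C_scale: "v \<in> C p P l \<Longrightarrow> (\<lambda>i. c * v i) \<in> C p P l"
  unfolding strand_def by auto

lemma C_uminus: "v \<in> C p P l \<Longrightarrow> - v \<in> C p P l"
  unfolding strand_def by auto

lemma C_diff: "v \<in> C p P l \<Longrightarrow> w \<in> C p P l \<Longrightarrow> v - w \<in> C p P l"
  using C_add[of v p P l "- w"] C_uminus[of w p P l] by simp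

lemma C_zero: "0 \<in> C p P l"
  unfolding strand_def by auto

lemma C_mono: "v \<in> C p P l \<Longrightarrow> Q \<subseteq> P \<Longrightarrow> v \<in> C p Q l"
  unfolding strand_def by blast

lemma C_lower:
  assumes "v \<in> C p P (l(q := l q - 1))" "q \<notin> P"
  shows "v \<in> C p P l"
proof -
  have "l(q := l q - 1) \<le> l" by (auto simp: le_fun_def)
  then show ?thesis using assms unfolding strand_def by (auto intro: order_trans)
qed

lemma proj_in_C: "v \<in> C p {} l \<Longrightarrow> proj p P l v \<in> C p P l"
  unfolding strand_def proj_def by auto

lemma proj_id: "v \<in> C p P l \<Longrightarrow> proj p P l v = v"
  unfolding strand_def proj_def by (auto simp: fun_eq_iff)

lemma proj_no_variables: "proj p {} l v = v"
  unfolding proj_def by auto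

lemma proj_proj: "Q \<subseteq> P \<Longrightarrow> proj p P l (proj p Q l v) = proj p P l v"
  unfolding proj_def by (auto simp: fun_eq_iff)

lemma proj_add: "proj p P l (v + w) = proj p P l v + proj p P l w"
  unfolding proj_def by (auto simp: fun_eq_iff)

lemma proj_diff: "proj p P l (v - w) = proj p P l v - proj p P l w"
  unfolding proj_def by (auto simp: fun_eq_iff)

lemma proj_zero: "proj p P l 0 = 0"
  unfolding proj_def by (auto simp: fun_eq_iff)

lemma proj_cong: "(\<And>x. x \<in> P \<Longrightarrow> l x = a x) \<Longrightarrow> proj p P l v = proj p P a v"
  unfolding proj_def by (auto simp: fun_eq_iff)

lemma app_add: "app p (v + w) = app p v + app p w"
  unfolding coeff_map_def by (auto simp: fun_eq_iff distrib_left sum.distrib)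

lemma app_diff: "app p (v - w) = app p v - app p w"
  unfolding coeff_map_def by (auto simp: fun_eq_iff right_diff_distrib sum_subtractf)

lemma app_scale: "app p (\<lambda>j. c * v j) = (\<lambda>i. c * app p v i)"
  unfolding coeff_map_def by (auto simp: fun_eq_iff sum_distrib_left intro!: sum.cong)

lemma bd_add: "bd p P l (v + w) = bd p P l v + bd p P l w"
  unfolding bd_def app_add proj_add ..

lemma bd_diff: "bd p P l (v - w) = bd p P l v - bd p P l w"
  unfolding bd_def app_diff proj_diff ..

lemma bd_scale: "bd p P l (\<lambda>j. c * v j) = (\<lambda>i. c * bd p P l v i)"
  unfolding bd_def app_scale proj_def by auto

lemma bd_cong: "(\<And>x. x \<in> P \<Longrightarrow> l x = a x) \<Longrightarrow> bd p P l v = bd p P a v"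
  unfolding bd_def by (rule proj_cong)

lemma app_in_C:
  assumes "v \<in> C (Suc p) {} l"
  shows "app p v \<in> C p {} l"
proof -
  have "deg p i \<le> l" if i: "app p v i \<noteq> 0" "i < r p" for i
  proof -
    obtain j where "j < r (Suc p)" "D p i j * v j \<noteq> 0"
      using i unfolding coeff_map_def by (auto elim!: sum.not_neutral_contains_not_neutral)
    then show ?thesis
      using D_graded[of p i j] i(2) assms unfolding strand_def by (auto intro: order_trans)
  qed
  then show ?thesis unfolding strand_def by (auto simp: coeff_map_def split: if_splits)
qed

lemma bd_in_C: "v \<in> C (Suc p) P l \<Longrightarrow> bd p P l v \<in> C p P l"
  unfolding bd_def by (intro proj_in_C app_in_C) (auto intro: C_mono)

text \<open>
  Reduction is a map of complexes: a basis element whose degree is smaller than \<open>l\<close> in some variable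
  of \<open>Q\<close> is mapped to multiples of basis elements with the same property.
\<close>
lemma proj_app_proj:
  assumes "v \<in> C (Suc p) {} l" "Q \<subseteq> P"
  shows "proj p P l (app p (proj (Suc p) Q l v)) = proj p P l (app p v)"
proof -
  have "D p i j * proj (Suc p) Q l v j = D p i j * v j"
    if i: "i < r p" "\<forall>x\<in>P. deg p i x = l x" and j: "j < r (Suc p)" for i j
  proof (cases "D p i j = 0 \<or> v j = 0")
    case False
    then have "deg p i \<le> deg (Suc p) j" "deg (Suc p) j \<le> l"
      using D_graded[of p i j] i j assms(1) unfolding strand_def by auto
    then have "\<forall>x\<in>Q. deg (Suc p) j x = l x"
      using i(2) assms(2) by (metis le_fun_def order_antisym subsetD)
    then show ?thesis by (simp add: proj_def)
  qed (auto simp: proj_def)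
  then show ?thesis
    unfolding proj_def[of p] coeff_map_def by (auto simp: fun_eq_iff intro!: sum.cong)
qed

lemma app_app: "v \<in> C (Suc (Suc p)) {} l \<Longrightarrow> app p (app (Suc p) v) = 0"
  using exact[of "app (Suc p) v" p l] app_in_C[of v "Suc p" l] by blast

lemma bd_bd:
  assumes "v \<in> C (Suc (Suc p)) P l"
  shows "bd p P l (bd (Suc p) P l v) = 0"
proof -
  have v: "v \<in> C (Suc (Suc p)) {} l" using assms by (rule C_mono) simp
  show ?thesis
    unfolding bd_def by (simp add: proj_app_proj[OF app_in_C[OF v]] app_app[OF v] proj_zero)
qed

definition Z :: "nat \<Rightarrow> 'n set \<Rightarrow> ('n \<Rightarrow> nat) \<Rightarrow> (nat \<Rightarrow> 'k) set" where
  "Z p P l = {v \<in> C p P l. case p of 0 \<Rightarrow> True | Suc p' \<Rightarrow> bd p' P l v = 0}"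

definition B :: "nat \<Rightarrow> 'n set \<Rightarrow> ('n \<Rightarrow> nat) \<Rightarrow> (nat \<Rightarrow> 'k) set" where
  "B p P l = bd p P l ` C (Suc p) P l"

lemma Z_subset_C: "Z p P l \<subseteq> C p P l"
  unfolding Z_def by auto

lemma Z_Suc: "Z (Suc p) P l = {v \<in> C (Suc p) P l. bd p P l v = 0}"
  unfolding Z_def by simp

text \<open>
  Exactness of \<open>0 \<rightarrow> C(P, l - \<epsilon>\<^sub>q) \<rightarrow> C(P, l) \<rightarrow> C(P \<union> {q}, l)\<close>: the basis elements supporting
  vectors in \<open>C p P l\<close> are either below \<open>l\<close> in the variable \<open>q\<close> or agree with \<open>l\<close> there.
\<close>
lemma C_lower_iff:
  assumes "q \<notin> P" "0 < l q" "v \<in> C p P l"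
  shows "v \<in> C p P (l(q := l q - 1)) \<longleftrightarrow> proj p (insert q P) l v = 0"
proof
  assume "v \<in> C p P (l(q := l q - 1))"
  then have "deg p i \<le> l(q := l q - 1)" if "v i \<noteq> 0" for i
    using that unfolding strand_def by blast
  then have "deg p i q \<le> l q - 1" if "v i \<noteq> 0" for i
    using that by (metis fun_upd_same le_funD)
  with assms(2) show "proj p (insert q P) l v = 0"
    by (auto simp: proj_def fun_eq_iff) fastforce
next
  assume 0: "proj p (insert q P) l v = 0"
  have "deg p i \<le> l(q := l q - 1)" if i: "v i \<noteq> 0" for i
  proof -
    have v: "deg p i \<le> l" "\<forall>x\<in>P. deg p i x = l x" using assms(3) i unfolding strand_def by auto
    then have "deg p i q \<noteq> l q"
      using fun_cong[OF 0, of i] i by (auto simp: proj_def split: if_splits)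
    then show ?thesis using v(1) by (auto simp: le_fun_def) (metis le_neq_implies_less Suc_pred
      assms(2) less_Suc_eq_le)
  qed
  then show "v \<in> C p P (l(q := l q - 1))"
    using assms(1,3) unfolding strand_def by auto
qed

text \<open>
  The next four lemmas are the part of the long exact homology sequence that the induction uses. The
  connecting map sends a cycle \<open>z\<close> of \<open>C(P \<union> {q}, l)\<close> to its boundary \<open>bd p P l z\<close> in \<open>C(P, l)\<close>, where
  \<open>z\<close> itself serves as its lift, since \<open>C(P \<union> {q}, l)\<close> is contained in \<open>C(P, l)\<close> as a graded vector
  space though not as a complex.
\<close>
context
  fixes P :: "'n set" and q :: 'n and l a :: "'n \<Rightarrow> nat"
  assumes q: "q \<notin> P" "0 < l q" and a: "a = l(q := l q - 1)"
begin

lemma bd_lower: "bd p P a v = bd p P l v"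
  by (rule bd_cong) (use q a in auto)

lemma bd_connecting:
  assumes "z \<in> Z (Suc p) (insert q P) l"
  shows "bd p P l z \<in> Z p P a"
proof -
  have z: "z \<in> C (Suc p) P l" "bd p (insert q P) l z = 0"
    using assms C_mono[of z _ "insert q P" l P] unfolding Z_Suc by auto
  have "proj p (insert q P) l (bd p P l z) = 0"
    using z(2) unfolding bd_def by (simp add: proj_proj subset_insertI)
  then have "bd p P l z \<in> C p P a"
    using C_lower_iff[OF q bd_in_C[OF z(1)]] a by simp
  moreover have "case p of 0 \<Rightarrow> True | Suc p' \<Rightarrow> bd p' P a (bd p P l z) = 0"
    using z(1) by (auto simp: bd_lower bd_bd split: nat.split)
  ultimately show ?thesis unfolding Z_def by simp
qed

text \<open>The connecting map is injective on homology classes if \<open>C(P, l)\<close> is exact in degree \<open>Suc p\<close>.\<close>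
lemma boundary_if_connecting_boundary:
  assumes z: "z \<in> Z (Suc p) (insert q P) l" and u: "bd p P l z \<in> B p P a"
    and acyclic: "Z (Suc p) P l \<subseteq> B (Suc p) P l"
  shows "z \<in> B (Suc p) (insert q P) l"
proof -
  obtain w where w: "w \<in> C (Suc p) P a" "bd p P l z = bd p P l w"
    using u unfolding B_def bd_lower by auto
  have wl: "w \<in> C (Suc p) P l" using w(1) q(1) unfolding a by (rule C_lower)
  have zl: "z \<in> C (Suc p) (insert q P) l" using z Z_subset_C by auto
  then have "z \<in> C (Suc p) P l" by (rule C_mono) auto
  then have "z - w \<in> Z (Suc p) P l"
    using w(2) wl by (auto simp: Z_Suc bd_diff C_diff)
  then obtain y where y: "y \<in> C (Suc (Suc p)) P l" "z - w = bd (Suc p) P l y"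
    using acyclic unfolding B_def by auto
  have y0: "y \<in> C (Suc (Suc p)) {} l" using y(1) by (rule C_mono) auto
  have w0: "proj (Suc p) (insert q P) l w = 0" using C_lower_iff[OF q wl] w(1) a by simp
  have "z = proj (Suc p) (insert q P) l (z - w)"
    by (simp add: proj_diff w0 proj_id[OF zl])
  also have "\<dots> = bd (Suc p) (insert q P) l (proj (Suc (Suc p)) (insert q P) l y)"
    unfolding y(2) bd_def by (simp add: proj_proj subset_insertI proj_app_proj[OF y0])
  finally show ?thesis using proj_in_C[OF y0] unfolding B_def by blast
qed

text \<open>The connecting map is well defined on homology classes.\<close>
lemma connecting_boundary_if_boundary:
  assumes "z \<in> B (Suc p) (insert q P) l"
  shows "bd p P l z \<in> B p P a"
proof -
  obtain y where y: "y \<in> C (Suc (Suc p)) (insert q P) l" "z = bd (Suc p) (insert q P) l y"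
    using assms unfolding B_def by auto
  have yP: "y \<in> C (Suc (Suc p)) P l" using y(1) by (rule C_mono) auto
  have zP: "z \<in> C (Suc p) P l"
    unfolding y(2) using bd_in_C[OF y(1)] by (rule C_mono) auto
  define w where "w = z - bd (Suc p) P l y"
  have w: "w \<in> C (Suc p) P l" unfolding w_def by (intro C_diff zP bd_in_C yP)
  have "proj (Suc p) (insert q P) l w = 0"
    unfolding w_def y(2) bd_def by (simp add: proj_diff proj_proj subset_insertI)
  then have "w \<in> C (Suc p) P a" using C_lower_iff[OF q w] a by simp
  moreover have "bd p P l z = bd p P a w"
    unfolding bd_lower w_def bd_diff bd_bd[OF yP] by simp
  ultimately show ?thesis unfolding B_def by blast
qed

text \<open>
  A class of \<open>C(P, a)\<close> that becomes zero in \<open>C(P, l)\<close> comes from \<open>C(P \<union> {q}, l)\<close>: if it is the boundary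
  of \<open>w\<close>, then the reduction of \<open>w\<close> modulo \<open>q\<close> is a cycle.
\<close>
lemma connecting_onto:
  assumes u: "u \<in> Z p P a" "u \<in> B p P l"
  obtains z where "z \<in> Z (Suc p) (insert q P) l" "u - bd p P l z \<in> B p P a"
proof -
  obtain w where w: "w \<in> C (Suc p) P l" "u = bd p P l w" using u(2) unfolding B_def by auto
  have w0: "w \<in> C (Suc p) {} l" using w(1) by (rule C_mono) auto
  define z where "z = proj (Suc p) (insert q P) l w"
  have z: "z \<in> C (Suc p) (insert q P) l" unfolding z_def by (rule proj_in_C[OF w0])
  then have zP: "z \<in> C (Suc p) P l" by (rule C_mono) auto
  have "proj (Suc p) (insert q P) l (w - z) = 0"
    unfolding z_def by (simp add: proj_diff proj_proj)
  then have "w - z \<in> C (Suc p) P a" using C_lower_iff[OF q C_diff[OF w(1) zP]] a by simp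
  then have "bd p P l (w - z) \<in> B p P a" unfolding B_def bd_lower by blast
  then have *: "u - bd p P l z \<in> B p P a" by (simp add: bd_diff w(2))
  have uC: "u \<in> C p P a" using u(1) Z_subset_C by auto
  then have ul: "u \<in> C p P l" using q(1) unfolding a by (rule C_lower)
  then have "0 = proj p (insert q P) l u" using C_lower_iff[OF q ul] uC a by simp
  also have "\<dots> = bd p (insert q P) l z"
    unfolding w(2) bd_def z_def by (simp add: proj_proj subset_insertI proj_app_proj[OF w0])
  finally have "z \<in> Z (Suc p) (insert q P) l" unfolding Z_Suc using z by simp
  with * show thesis using that by blast
qed

end

text \<open>
  The composite of the connecting maps for the variables of \<open>P\<close>, followed by the augmentation. It
  identifies the homology of \<open>C(P, l)\<close> in degree \<open>length P\<close> with the socle. A list fixes the order in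
  which the variables are added. That the form depends only on the values of \<open>l\<close> on \<open>P\<close> makes it
  natural: the forms for \<open>l\<close> and for \<open>l - \<epsilon>\<^sub>q\<close> with \<open>q \<notin> P\<close> are the same function.
\<close>
fun socle_form :: "'n list \<Rightarrow> ('n \<Rightarrow> nat) \<Rightarrow> (nat \<Rightarrow> 'k) \<Rightarrow> 'k" where
  "socle_form [] l v = (\<Sum>j<r 0. e j * v j)"
| "socle_form (q # P) l v = socle_form P l (bd (length P) (set P) l v)"

lemma socle_form_add: "socle_form P l (v + w) = socle_form P l v + socle_form P l w"
  by (induction P arbitrary: v w) (auto simp: bd_add distrib_left sum.distrib)

lemma socle_form_scale: "socle_form P l (\<lambda>j. c * v j) = c * socle_form P l v"
  by (induction P arbitrary: v) (auto simp: bd_scale sum_distrib_left intro!: sum.cong)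

lemma socle_form_diff: "socle_form P l (v - w) = socle_form P l v - socle_form P l w"
  using socle_form_add[of P l "v - w" w] by simp

lemma socle_form_cong: "(\<And>x. x \<in> set P \<Longrightarrow> l x = a x) \<Longrightarrow> socle_form P l v = socle_form P a v"
  by (induction P arbitrary: v) (auto simp: bd_cong[of _ l a])

text \<open>
  In the step from \<open>P\<close> to \<open>q # P\<close> with \<open>a = l - \<epsilon>\<^sub>q\<close>, the homology in degree \<open>length P + 1\<close> is the kernel
  of the map from the homology of \<open>C(P, a)\<close> to that of \<open>C(P, l)\<close> in degree \<open>length P\<close>. If \<open>a\<close> is not a
  socle degree for \<open>P\<close>, the source is zero. If both \<open>a\<close> and \<open>l\<close> are socle degrees for \<open>P\<close>, the map is
  injective, as the same form detects nonzero classes on both sides. If \<open>a\<close> is one and \<open>l\<close> is not, the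
  target is zero, and the kernel is the whole source. By \<open>socle_deg_insert\<close> the last case is the one
  in which \<open>l\<close> is a socle degree for \<open>q # P\<close>.
\<close>
lemma homology_strand:
  assumes "distinct P"
  shows "(\<forall>p>length P. Z p (set P) l \<subseteq> B p (set P) l) \<and>
    (if socle_deg U (set P) l
     then (\<forall>z\<in>Z (length P) (set P) l. z \<in> B (length P) (set P) l \<longleftrightarrow> socle_form P l z = 0) \<and>
          (\<exists>z\<in>Z (length P) (set P) l. socle_form P l z \<noteq> 0)
     else Z (length P) (set P) l \<subseteq> B (length P) (set P) l)"
  using assms
proof (induction P arbitrary: l)
  case Nil
  have B: "B p {} l = app p ` C (Suc p) {} l" for p
    unfolding B_def bd_def proj_no_variables ..
  have "Z p {} l \<subseteq> B p {} l" if "p > 0" for p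
    using that exact unfolding B by (cases p) (auto simp: Z_Suc bd_def proj_no_variables)
  moreover have "socle_deg U {} l \<longleftrightarrow> l \<notin> U" by (auto simp: socle_deg_def lower_def)
  moreover have "Z 0 {} l = C 0 {} l" unfolding Z_def by simp
  ultimately show ?case using exact_aug[of _ l] aug_onto[of l] B by auto
next
  case (Cons q P)
  then have q: "q \<notin> set P" and IH: "\<And>p l. length P < p \<Longrightarrow> Z p (set P) l \<subseteq> B p (set P) l"
    "\<And>l z. socle_deg U (set P) l \<Longrightarrow> z \<in> Z (length P) (set P) l \<Longrightarrow>
       z \<in> B (length P) (set P) l \<longleftrightarrow> socle_form P l z = 0"
    "\<And>l. socle_deg U (set P) l \<Longrightarrow> \<exists>z\<in>Z (length P) (set P) l. socle_form P l z \<noteq> 0"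
    "\<And>l. \<not> socle_deg U (set P) l \<Longrightarrow> Z (length P) (set P) l \<subseteq> B (length P) (set P) l"
    by (auto split: if_splits)
  show ?case
  proof (cases "l q = 0")
    case True
    \<comment> \<open>Every basis element of degree at most \<open>l\<close> agrees with \<open>l\<close> at \<open>q\<close>.\<close>
    have deg: "deg p i q = l q" if "deg p i \<le> l" for p i
      using that True by (metis le_funD le_zero_eq)
    have C: "C p (insert q (set P)) l = C p (set P) l" for p
      unfolding strand_def using deg by blast
    have bd: "bd p (insert q (set P)) l v = bd p (set P) l v" if "v \<in> C (Suc p) (set P) l" for p v
    proof -
      have "app p v \<in> C p {} l" by (rule app_in_C, rule C_mono[OF that]) simp
      then have "deg p i q = l q" if "app p v i \<noteq> 0" for i
        using that unfolding strand_def by (intro deg) auto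
      then have "bd p (insert q (set P)) l v i = bd p (set P) l v i" for i
        by (cases "app p v i = 0") (simp_all add: bd_def proj_def)
      then show ?thesis by (rule ext)
    qed
    have "Z p (insert q (set P)) l = Z p (set P) l" for p
      unfolding Z_def C by (auto simp: bd split: nat.splits)
    moreover have "B p (insert q (set P)) l = B p (set P) l" for p
      unfolding B_def C by (auto simp: bd)
    moreover have "\<not> socle_deg U (insert q (set P)) l"
      using True by (auto simp: socle_deg_def)
    ultimately show ?thesis using IH(1)[of _ l] by simp
  next
    case False
    then have l: "0 < l q" by simp
    define a where "a = l(q := l q - 1)"
    note ctx = q l a_def
    have socle_form: "socle_form P l v = socle_form P a v" for v
      by (rule socle_form_cong) (use q in \<open>auto simp: a_def\<close>)
    have phiB: "socle_form P a v = 0" if "socle_deg U (set P) a" "v \<in> B (length P) (set P) a" for v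
    proof -
      have "v \<in> Z (length P) (set P) a"
        using that(2) unfolding B_def Z_def by (auto simp: bd_in_C bd_bd split: nat.split)
      then show ?thesis using that IH(2) by blast
    qed
    have sub: "Z p (insert q (set P)) l \<subseteq> B p (insert q (set P)) l" if "p > Suc (length P)" for p
    proof -
      obtain p' where p': "p = Suc p'" "p' > length P" using \<open>p > _\<close> by (cases p) auto
      show ?thesis
        using boundary_if_connecting_boundary[OF ctx, of _ p'] bd_connecting[OF ctx, of _ p']
          IH(1)[OF p'(2), of a] IH(1)[of "Suc p'" l] p' by auto
    qed
    have crit: "z \<in> B (Suc (length P)) (insert q (set P)) l"
      if "z \<in> Z (Suc (length P)) (insert q (set P)) l"
        "bd (length P) (set P) l z \<in> B (length P) (set P) a" for z
      using boundary_if_connecting_boundary[OF ctx that] IH(1) by simp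
    have socle: "socle_deg U (insert q (set P)) l \<longleftrightarrow>
        socle_deg U (set P) a \<and> \<not> socle_deg U (set P) l"
      unfolding a_def by (rule socle_deg_insert) (use q l U_up in auto)
    show ?thesis
    proof (cases "socle_deg U (insert q (set P)) l")
      case True
      then have sa: "socle_deg U (set P) a" and sl: "\<not> socle_deg U (set P) l"
        using socle by auto
      have "z \<in> B (Suc (length P)) (insert q (set P)) l \<longleftrightarrow> socle_form (q # P) l z = 0"
        if z: "z \<in> Z (Suc (length P)) (insert q (set P)) l" for z
        using crit[OF z] connecting_boundary_if_boundary[OF ctx, of z]
          IH(2)[OF sa bd_connecting[OF ctx z]] by (auto simp: socle_form)
      moreover
      obtain u where u: "u \<in> Z (length P) (set P) a" "socle_form P a u \<noteq> 0"
        using IH(3)[OF sa] by blast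
      have "u \<in> C (length P) (set P) l"
        using subsetD[OF Z_subset_C u(1)] q unfolding a_def by (rule C_lower)
      then have "u \<in> Z (length P) (set P) l"
        using u(1) bd_lower[OF ctx] unfolding Z_def by (auto split: nat.splits)
      then have "u \<in> B (length P) (set P) l" using IH(4)[OF sl] by blast
      then obtain z where z: "z \<in> Z (Suc (length P)) (insert q (set P)) l"
          "u - bd (length P) (set P) l z \<in> B (length P) (set P) a"
        using connecting_onto[OF ctx u(1)] by blast
      have "socle_form P a u = socle_form P a (bd (length P) (set P) l z)"
        using phiB[OF sa z(2)] by (simp add: socle_form_diff)
      then have "socle_form (q # P) l z \<noteq> 0" using u(2) by (simp add: socle_form)
      ultimately show ?thesis using True sub z(1) by auto
    next
      case False
      have "bd (length P) (set P) l z \<in> B (length P) (set P) a"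
        if z: "z \<in> Z (Suc (length P)) (insert q (set P)) l" for z
      proof (cases "socle_deg U (set P) a")
        case True
        then have sl: "socle_deg U (set P) l" using False socle by blast
        have zP: "z \<in> C (Suc (length P)) (set P) l"
          using subsetD[OF Z_subset_C z] by (rule C_mono) auto
        then have u: "bd (length P) (set P) l z \<in> B (length P) (set P) l" unfolding B_def by blast
        moreover have "bd (length P) (set P) l z \<in> Z (length P) (set P) l"
          using zP unfolding Z_def by (auto simp: bd_in_C bd_bd split: nat.split)
        ultimately have "socle_form P l (bd (length P) (set P) l z) = 0" using IH(2)[OF sl] by blast
        then show ?thesis using IH(2)[OF True bd_connecting[OF ctx z]] by (simp add: socle_form)
      next
        case False
        then show ?thesis using IH(4) bd_connecting[OF ctx z] by blast
      qed
      then show ?thesis using False sub crit by auto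
    qed
  qed
qed

end

text \<open>
  Modulo all variables, a minimal resolution has zero differential, so that every vector is a cycle
  and only \<open>0\<close> is a boundary. The form then has trivial kernel on the vectors supported on the basis
  elements of degree \<open>l\<close> if \<open>l\<close> is a socle degree, and there are no such elements otherwise.
\<close>
theorem (in coefficient_resolution) rank_top_strand:
  assumes minimal: "\<And>p i j. i < r p \<Longrightarrow> j < r (Suc p) \<Longrightarrow> deg p i = deg (Suc p) j \<Longrightarrow> D p i j = 0"
    and fin: "finite (UNIV :: 'n set)"
  shows "card {j. j < r CARD('n) \<and> deg CARD('n) j = l} = (if socle_deg U UNIV l then 1 else 0)"
proof -
  obtain P :: "'n list" where P: "set P = UNIV" "distinct P" using finite_distinct_list[OF fin] by blast
  let ?n = "CARD('n)"
  have len: "length P = ?n" using P distinct_card by metis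
  let ?J = "{j. j < r ?n \<and> deg ?n j = l}"
  have C: "C p UNIV l = {v. \<forall>j. v j \<noteq> 0 \<longrightarrow> j < r p \<and> deg p j = l}" for p
    unfolding strand_def by auto
  have bd0: "bd p UNIV l v = 0" if "v \<in> C (Suc p) UNIV l" for p v
  proof -
    have "D p i j * v j = 0" if "i < r p" "j < r (Suc p)" "deg p i = l" for i j
      using minimal[of i p j] that \<open>v \<in> _\<close> unfolding C by auto
    then show ?thesis
      unfolding bd_def proj_def coeff_map_def by (auto simp: fun_eq_iff intro!: sum.neutral)
  qed
  have Z: "Z p UNIV l = C p UNIV l" for p
    unfolding Z_def using bd0 by (cases p) auto
  have B: "B ?n UNIV l = {0}"
  proof -
    have "bd ?n UNIV l ` C (Suc ?n) UNIV l = (\<lambda>_. 0) ` C (Suc ?n) UNIV l"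
      using bd0 by (intro image_cong) auto
    then show ?thesis
      unfolding B_def using C_zero[of "Suc ?n" UNIV l] by (auto simp: image_constant_conv)
  qed
  define unit :: "nat \<Rightarrow> nat \<Rightarrow> 'k" where "unit = (\<lambda>j i. if i = j then 1 else 0)"
  have unit: "unit j \<in> C ?n UNIV l" "unit j \<noteq> 0" if "j \<in> ?J" for j
    using that unfolding C unit_def by (auto simp: fun_eq_iff)
  note main = homology_strand[OF P(2), of l, unfolded P(1) len Z B]
  show ?thesis
  proof (cases "socle_deg U UNIV l")
    case False
    then have "?J = {}" using main unit by fastforce
    then show ?thesis using False by auto
  next
    case True
    then have phi0: "v = 0 \<longleftrightarrow> socle_form P l v = 0" if "v \<in> C ?n UNIV l" for v using main that by auto
    obtain v where "v \<in> C ?n UNIV l" "socle_form P l v \<noteq> 0" using True main by auto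
    then have "v \<noteq> 0" using phi0 by blast
    then obtain j where "v j \<noteq> 0" by (auto simp: fun_eq_iff)
    then have j: "j \<in> ?J" using \<open>v \<in> _\<close> unfolding C by auto
    have uniq: "j' = j" if j': "j' \<in> ?J" for j'
    proof (rule ccontr)
      assume "j' \<noteq> j"
      \<comment> \<open>The combination of the two unit vectors on which the form vanishes.\<close>
      define w where "w = (\<lambda>i. socle_form P l (unit j') * unit j i) - (\<lambda>i. socle_form P l (unit j) * unit j' i)"
      have "w \<in> C ?n UNIV l" unfolding w_def by (intro C_diff C_scale unit j j')
      moreover have "socle_form P l w = 0" unfolding w_def socle_form_diff socle_form_scale by simp
      ultimately have "w = 0" using phi0 by blast
      moreover have "w j = socle_form P l (unit j')"
        using \<open>j' \<noteq> j\<close> unfolding w_def by (simp add: unit_def)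
      ultimately have "socle_form P l (unit j') = 0" by simp
      then show False using phi0[OF unit(1)[OF j']] unit(2)[OF j'] by simp
    qed
    have "?J = {j}"
    proof
      show "?J \<subseteq> {j}" using uniq by (intro subsetI) simp
    qed (use j in simp)
    then show ?thesis using True by simp
  qed
qed

section \<open>Monomial ideals and their minimal generators\<close>

text \<open>Divisibility of monomials is the pointwise order of their exponent functions.\<close>
lemma mon_add_diff:
  fixes a b :: "'n mon"
  assumes "lookup a \<le> lookup b"
  shows "a + (b - a) = b" "(b - a) + a = b"
  using assms by (auto simp: poly_mapping_eq_iff fun_eq_iff lookup_add lookup_minus le_fun_def)

lemma lookup_le_add: "lookup a \<le> lookup (a + b)" "lookup b \<le> lookup (a + b)" for a b :: "'n mon"
  by (auto simp: le_fun_def lookup_add)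

lemma lookup_Abs_mon [simp]: "lookup (Abs_poly_mapping f) = f" for f :: "'n::finite \<Rightarrow> nat"
  by (rule lookup_Abs_poly_mapping) simp

lemma lookup_single_times:
  fixes p :: "('n, 'k::field) mpoly"
  shows "lookup (Poly_Mapping.single a c * p) b =
    (if lookup a \<le> lookup b then c * lookup p (b - a) else 0)"
proof -
  have "lookup (Poly_Mapping.single a c * p) b =
      (\<Sum>l. (c when a = l) * (\<Sum>q. lookup p q when b = l + q))"
    by (simp add: lookup_mult lookup_single)
  also have "\<dots> = (\<Sum>l. c * (\<Sum>q. lookup p q when b = l + q) when a = l)"
    by (simp add: when_mult)
  also have "\<dots> = c * (\<Sum>q. lookup p q when b = a + q)" by simp
  also have "\<dots> = (if lookup a \<le> lookup b then c * lookup p (b - a) else 0)"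
  proof (cases "lookup a \<le> lookup b")
    case True
    then have "b = a + q \<longleftrightarrow> b - a = q" for q
      using mon_add_diff[OF True] by auto
    then show ?thesis using True by simp
  next
    case False
    then have "b \<noteq> a + q" for q using lookup_le_add by auto
    then show ?thesis using False by simp
  qed
  finally show ?thesis .
qed

lemma mpoly_sum_monomials:
  fixes p :: "('n, 'k::field) mpoly"
  shows "p = (\<Sum>b\<in>keys p. Poly_Mapping.single b (lookup p b))"
  by (rule poly_mapping_eqI) (auto simp: lookup_sum lookup_single when_def in_keys_iff)

lemma module_times: "Modules.module ((*) :: 'a::comm_ring_1 \<Rightarrow> 'a \<Rightarrow> 'a)"
  by standard (auto simp: algebra_simps)

lemma ideal_gen_mono_iff:
  fixes p :: "('n, 'k::field) mpoly"
  shows "p \<in> ideal_gen (mono_of ` A) \<longleftrightarrow> (\<forall>b\<in>keys p. \<exists>a\<in>A. lookup a \<le> lookup b)"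
proof -
  interpret S: Modules.module "(*) :: ('n, 'k) mpoly \<Rightarrow> _" by (rule module_times)
  show ?thesis unfolding ideal_gen_def
  proof
    assume "p \<in> S.span (mono_of ` A)"
    then show "\<forall>b\<in>keys p. \<exists>a\<in>A. lookup a \<le> lookup b"
    proof (induction p rule: S.span_induct_alt)
      case (step c x y)
      then obtain a where a: "a \<in> A" "x = mono_of a" by auto
      show ?case
      proof
        fix b assume "b \<in> keys (c * x + y)"
        then consider "b \<in> keys (c * x)" | "b \<in> keys y" using keys_add[of "c * x" y] by blast
        then show "\<exists>a\<in>A. lookup a \<le> lookup b"
        proof cases
          case 1
          then obtain b' where "b = b' + a"
            using keys_mult[of c x] by (auto simp: a(2) mono_of_def split: if_splits)
          then show ?thesis using a(1) lookup_le_add by blast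
        qed (use step in blast)
      qed
    qed simp
  next
    assume *: "\<forall>b\<in>keys p. \<exists>a\<in>A. lookup a \<le> lookup b"
    have "Poly_Mapping.single b (lookup p b) \<in> S.span (mono_of ` A)" if b: "b \<in> keys p" for b
    proof -
      obtain a where a: "a \<in> A" "lookup a \<le> lookup b" using * b by blast
      have "Poly_Mapping.single b (lookup p b) = Poly_Mapping.single (b - a) (lookup p b) * mono_of a"
        unfolding mono_of_def mult_single mon_add_diff(2)[OF a(2)] by simp
      then show ?thesis using a(1) S.span_scale S.span_base by (metis imageI)
    qed
    then show "p \<in> S.span (mono_of ` A)"
      by (subst mpoly_sum_monomials) (auto intro: S.span_sum)
  qed
qed

text \<open>Exponents are taken as functions, to match the degrees used for strands.\<close>
definition exponents :: "('n, 'k::field) mpoly set \<Rightarrow> ('n \<Rightarrow> nat) set" where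
  "exponents M = lookup ` {a. mono_of a \<in> M}"

lemma lookup_in_exponents [simp]: "lookup a \<in> exponents M \<longleftrightarrow> mono_of a \<in> M"
  unfolding exponents_def by (auto simp: lookup_inject)

lemma mono_of_in_ideal_gen:
  "(mono_of b :: ('n, 'k::field) mpoly) \<in> ideal_gen (mono_of ` A) \<longleftrightarrow> (\<exists>a\<in>A. lookup a \<le> lookup b)"
  by (simp add: ideal_gen_mono_iff) (simp add: mono_of_def)

lemma monomial_ideal_iff:
  assumes "monomial_ideal M"
  shows "p \<in> M \<longleftrightarrow> (\<forall>b\<in>keys p. lookup b \<in> exponents M)"
proof -
  obtain A where M: "M = ideal_gen (mono_of ` A)" using assms unfolding monomial_ideal_def by auto
  show ?thesis unfolding lookup_in_exponents M mono_of_in_ideal_gen by (rule ideal_gen_mono_iff)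
qed

lemma exponents_up:
  fixes M :: "('n::finite, 'k::field) mpoly set"
  assumes "monomial_ideal M" "f \<in> exponents M" "f \<le> g"
  shows "g \<in> exponents M"
proof -
  obtain A where M: "M = ideal_gen (mono_of ` A)" using assms(1) unfolding monomial_ideal_def by auto
  obtain a where a: "f = lookup a" using assms(2) unfolding exponents_def by auto
  have "lookup (Abs_poly_mapping g) \<in> exponents M"
    using assms(2,3) unfolding a lookup_in_exponents M mono_of_in_ideal_gen
    by (auto intro: order_trans)
  then show ?thesis by simp
qed

lemma minimal_monomial_below:
  fixes b :: "'n::finite mon"
  assumes "b \<in> V"
  obtains a where "a \<in> V" "lookup a \<le> lookup b" "\<And>c. c \<in> V \<Longrightarrow> lookup c \<le> lookup a \<Longrightarrow> c = a"
proof -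
  define s where "s = (\<lambda>a::'n mon. \<Sum>x\<in>UNIV. lookup a x)"
  obtain a where a: "a \<in> V \<and> lookup a \<le> lookup b"
      "\<And>c. c \<in> V \<and> lookup c \<le> lookup b \<Longrightarrow> s a \<le> s c"
    using ex_has_least_nat[of "\<lambda>a. a \<in> V \<and> lookup a \<le> lookup b" b s] assms by auto
  have "c = a" if c: "c \<in> V" "lookup c \<le> lookup a" for c
  proof (rule ccontr)
    assume "c \<noteq> a"
    then obtain x where "lookup c x < lookup a x"
      using c(2) by (metis le_fun_def order_le_imp_less_or_eq poly_mapping_eqI)
    then have "s c < s a"
      unfolding s_def using c(2) by (intro sum_strict_mono_ex1) (auto simp: le_fun_def)
    moreover have "s a \<le> s c" using a c by (blast intro: order_trans)
    ultimately show False by simp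
  qed
  then show thesis using a(1) that by blast
qed

text \<open>
  The minimal monomials of \<open>M\<close> generate \<open>M\<close>, since divisibility is well-founded, and every set of
  monomials generating \<open>M\<close> contains them. Therefore they are the only minimal generating set, and the
  definite description has a value.
\<close>
lemma min_gens_monomial_ideal:
  fixes M :: "('n::finite, 'k::field) mpoly set"
  assumes "monomial_ideal M"
  shows "min_gens M = {a. mono_of a \<in> M \<and> (\<forall>c. mono_of c \<in> M \<longrightarrow> lookup c \<le> lookup a \<longrightarrow> c = a)}"
    (is "_ = ?G")
proof -
  have gen: "ideal_gen (mono_of ` H) = M \<longleftrightarrow>
      (\<forall>b. mono_of b \<in> M \<longleftrightarrow> (\<exists>a\<in>H. lookup a \<le> lookup b))" for H
  proof
    assume "\<forall>b. mono_of b \<in> M \<longleftrightarrow> (\<exists>a\<in>H. lookup a \<le> lookup b)"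
    then have "p \<in> ideal_gen (mono_of ` H) \<longleftrightarrow> p \<in> M" for p
      by (subst monomial_ideal_iff[OF assms]) (simp add: ideal_gen_mono_iff)
    then show "ideal_gen (mono_of ` H) = M" by blast
  qed (use mono_of_in_ideal_gen[where 'k='k] in blast)
  have gG: "ideal_gen (mono_of ` ?G) = M"
    unfolding gen
  proof (intro allI iffI)
    fix b assume "mono_of b \<in> M"
    then have "b \<in> {a. mono_of a \<in> M}" by simp
    then obtain a where "a \<in> {a. mono_of a \<in> M}" "lookup a \<le> lookup b"
        "\<And>c. c \<in> {a. mono_of a \<in> M} \<Longrightarrow> lookup c \<le> lookup a \<Longrightarrow> c = a"
      by (rule minimal_monomial_below) blast
    then show "\<exists>a\<in>?G. lookup a \<le> lookup b" by blast
  next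
    fix b assume "\<exists>a\<in>?G. lookup a \<le> lookup b"
    then obtain a where "mono_of a \<in> M" "lookup a \<le> lookup b" by blast
    then show "mono_of b \<in> M"
      using exponents_up[OF assms, of "lookup a" "lookup b"] by simp
  qed
  have sub: "?G \<subseteq> H" if "ideal_gen (mono_of ` H) = M" for H
  proof
    fix a assume a: "a \<in> ?G"
    have H: "mono_of b \<in> M \<longleftrightarrow> (\<exists>a\<in>H. lookup a \<le> lookup b)" for b
      using that unfolding gen by (rule spec)
    have "mono_of a \<in> M" using a by simp
    then obtain h where h: "h \<in> H" "lookup h \<le> lookup a" unfolding H by blast
    moreover have "mono_of h \<in> M" unfolding H using h(1) by blast
    ultimately have "h = a" using a by blast
    then show "a \<in> H" using h(1) by simp
  qed
  show ?thesis
    unfolding min_gens_def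
  proof (rule the_equality)
    show "ideal_gen (mono_of ` ?G) = M \<and> (\<forall>H\<subset>?G. ideal_gen (mono_of ` H) \<noteq> M)"
      using gG sub by blast
  next
    fix H assume "ideal_gen (mono_of ` H) = M \<and> (\<forall>H'\<subset>H. ideal_gen (mono_of ` H') \<noteq> M)"
    then show "H = ?G" using gG sub[of H] by blast
  qed
qed

lemma exponents_iff_min_gens:
  fixes M :: "('n::finite, 'k::field) mpoly set"
  assumes "monomial_ideal M"
  shows "f \<in> exponents M \<longleftrightarrow> (\<exists>g\<in>min_gens M. lookup g \<le> f)"
proof
  assume "f \<in> exponents M"
  then obtain b where b: "b \<in> {a. mono_of a \<in> M}" "f = lookup b" unfolding exponents_def by auto
  obtain a where "a \<in> {a. mono_of a \<in> M}" "lookup a \<le> lookup b"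
      "\<And>c. c \<in> {a. mono_of a \<in> M} \<Longrightarrow> lookup c \<le> lookup a \<Longrightarrow> c = a"
    by (rule minimal_monomial_below[OF b(1)]) blast
  then show "\<exists>g\<in>min_gens M. lookup g \<le> f"
    unfolding min_gens_monomial_ideal[OF assms] b(2) by blast
next
  assume "\<exists>g\<in>min_gens M. lookup g \<le> f"
  then show "f \<in> exponents M"
    using exponents_up[OF assms] unfolding min_gens_monomial_ideal[OF assms]
    by (metis (mono_tags, lifting) lookup_in_exponents mem_Collect_eq)
qed

section \<open>Socle degrees and dominant sets\<close>

lemma lookup_lcm_mon_eq:
  assumes "finite D" "m \<in> D" "\<And>m'. m' \<in> D \<Longrightarrow> lookup m' x \<le> lookup m x"
  shows "lookup (lcm_mon D) x = lookup m x"
  unfolding lookup_lcm_mon using assms by (intro Max_eqI) auto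

lemma strongly_divides_iff_lower:
  assumes "\<And>x. 0 < lookup l x"
  shows "strongly_divides m l \<longleftrightarrow> lookup m \<le> lower UNIV (lookup l)"
proof -
  have "(lookup m x \<noteq> 0 \<longrightarrow> lookup m x < lookup l x) \<longleftrightarrow> lookup m x \<le> lookup l x - 1" for x
    using assms[of x] by auto
  then show ?thesis unfolding strongly_divides_def lower_def le_fun_def by simp
qed

text \<open>
  Dominance assigns a variable to each element of \<open>D\<close>, and the assignment is a bijection by
  cardinality. The element assigned to \<open>x\<close> attains the lcm in \<open>x\<close> only; hence it divides
  \<open>l - 1 + \<epsilon>\<^sub>x\<close>.
\<close>
lemma socle_deg_if_dominant_family:
  fixes M :: "('n::finite, 'k::field) mpoly set"
  assumes M: "monomial_ideal M" and D: "D \<in> dominant_family M"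
  shows "socle_deg (exponents M) UNIV (lookup (lcm_mon D))"
proof -
  let ?l = "lookup (lcm_mon D)"
  have D': "D \<subseteq> min_gens M" "dominant_set D" "card D = CARD('n)"
    "\<And>m. m \<in> min_gens M \<Longrightarrow> \<not> strongly_divides m (lcm_mon D)"
    using D unfolding dominant_family_def by auto
  have fin: "finite D" using D'(3) by (metis card.infinite zero_less_card_finite less_irrefl)
  obtain X where X: "\<And>m m'. m \<in> D \<Longrightarrow> m' \<in> D \<Longrightarrow> m' \<noteq> m \<Longrightarrow> lookup m' (X m) < lookup m (X m)"
    using D'(2) unfolding dominant_set_def dominant_def by (metis DiffI singletonD)
  have inj: "inj_on X D"
    by (rule inj_onI) (metis X less_asym)
  have surj: "X ` D = UNIV"
    using inj D'(3) by (intro card_subset_eq) (auto simp: card_image)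
  have lcm: "?l (X m) = lookup m (X m)" if "m \<in> D" for m
    by (rule lookup_lcm_mon_eq[OF fin that]) (metis X[OF that] less_imp_le order_refl)
  have less: "lookup m' (X m) < ?l (X m)" if "m \<in> D" "m' \<in> D" "m' \<noteq> m" for m m'
    using X that lcm by simp
  \<comment> \<open>If the lcm had exponent 0 in \<open>x\<close>, no other element could be smaller in \<open>x\<close> than the one assigned to
      \<open>x\<close>; then there is one variable only and \<open>D\<close> consists of the monomial 1, which strongly divides
      every monomial.\<close>
  have pos: "0 < ?l x" for x
  proof (rule ccontr)
    obtain m where m: "m \<in> D" "X m = x" using surj by (metis UNIV_I imageE)
    assume 0: "\<not> 0 < ?l x"
    have "D = {m}" using less[OF m(1)] m 0 by fastforce
    then have "(UNIV :: 'n set) = {x}" using surj m by auto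
    then have "lookup m y = 0" for y
      using lcm[OF m(1)] m(2) 0 by (metis UNIV_I bot_nat_0.not_eq_extremum singletonD)
    then have "strongly_divides m (lcm_mon D)" unfolding strongly_divides_def by simp
    then show False using D'(1,4) m(1) by blast
  qed
  moreover have "lower UNIV ?l \<notin> exponents M"
    using D'(4) strongly_divides_iff_lower[OF pos] exponents_iff_min_gens[OF M] by blast
  moreover have "lower (UNIV - {x}) ?l \<in> exponents M" for x
  proof -
    obtain m where m: "m \<in> D" "X m = x" using surj by (metis UNIV_I imageE)
    have "lookup m y \<le> lower (UNIV - {x}) ?l y" for y
    proof (cases "y = x")
      case True
      then show ?thesis using lcm[OF m(1)] m(2) by (simp add: lower_def)
    next
      case False
      obtain m' where m': "m' \<in> D" "X m' = y" using surj by (metis UNIV_I imageE)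
      then have "lookup m y < ?l y" using less[OF m'(1) m(1)] m m' False by auto
      then show ?thesis using False by (simp add: lower_def)
    qed
    then have "lookup m \<le> lower (UNIV - {x}) ?l" by (rule le_funI)
    then show ?thesis
      using exponents_iff_min_gens[OF M] m(1) D'(1) by blast
  qed
  ultimately show ?thesis unfolding socle_deg_def by simp
qed

lemma dominant_family_if_socle_deg:
  fixes M :: "('n::finite, 'k::field) mpoly set"
  assumes M: "monomial_ideal M" and l: "socle_deg (exponents M) UNIV (lookup l)"
  obtains D where "D \<in> dominant_family M" "l = lcm_mon D"
proof -
  have pos: "0 < lookup l x" for x using l unfolding socle_deg_def by simp
  have no: "\<not> lookup m \<le> lower UNIV (lookup l)" if "m \<in> min_gens M" for m
    using l that exponents_iff_min_gens[OF M] unfolding socle_deg_def by blast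
  have "\<exists>m\<in>min_gens M. lookup m \<le> lower (UNIV - {x}) (lookup l)" for x
    using l exponents_iff_min_gens[OF M] unfolding socle_deg_def by blast
  then obtain g where g: "\<And>x. g x \<in> min_gens M"
      "\<And>x. lookup (g x) \<le> lower (UNIV - {x}) (lookup l)" by metis
  have off: "lookup (g x) y < lookup l y" if "y \<noteq> x" for x y
    using g(2)[of x] pos[of y] that unfolding le_fun_def lower_def
    by (auto dest!: spec[of _ y])
  have on: "lookup (g x) x = lookup l x" for x
  proof (rule ccontr)
    assume "lookup (g x) x \<noteq> lookup l x"
    then have "lookup (g x) x < lookup l x"
      using g(2)[of x] unfolding le_fun_def lower_def by (auto dest!: spec[of _ x])
    then have "lookup (g x) y < lookup l y" for y using off by (cases "y = x") auto
    then have "lookup (g x) \<le> lower UNIV (lookup l)"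
      unfolding le_fun_def lower_def by (metis (full_types) UNIV_I Suc_pred' less_Suc_eq_le pos)
    then show False using no g(1) by blast
  qed
  have inj: "inj g" by (rule injI) (metis on off less_irrefl)
  have lcm: "lcm_mon (range g) = l"
  proof (rule poly_mapping_eqI)
    fix x
    have "lookup (lcm_mon (range g)) x = lookup (g x) x"
      by (rule lookup_lcm_mon_eq) (use on off in \<open>auto, metis less_imp_le order_refl\<close>)
    then show "lookup (lcm_mon (range g)) x = lookup l x" using on by simp
  qed
  have "dominant_set (range g)"
    unfolding dominant_set_def dominant_def
  proof (intro ballI conjI)
    fix m assume "m \<in> range g"
    then obtain x where x: "m = g x" by auto
    have "\<forall>m'\<in>range g - {m}. lookup m' x < lookup m x"
      unfolding x using on off by (metis DiffE imageE insertI1)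
    then show "\<exists>x. \<forall>m'\<in>range g - {m}. lookup m' x < lookup m x" ..
  qed
  then have "range g \<in> dominant_family M"
    unfolding dominant_family_def using g(1) no card_image[OF inj]
    by (auto simp: lcm strongly_divides_iff_lower[OF pos])
  then show thesis using that lcm by blast
qed

section \<open>Homogeneous components of graded modules\<close>

abbreviation mstrand :: "'n mon list \<Rightarrow> 'n mon \<Rightarrow> (nat \<Rightarrow> 'k::zero) set" where
  "mstrand ds l \<equiv> strand (length ds) (\<lambda>j. lookup (ds ! j)) {} (lookup l)"

lemma mstrand_def: "mstrand ds l = {c. \<forall>j. c j \<noteq> 0 \<longrightarrow> j < length ds \<and> lookup (ds ! j) \<le> lookup l}"
  by (simp add: strand_def)

text \<open>
  The coefficients of the part of degree \<open>l\<close> of \<open>v\<close>: in degree \<open>l\<close>, basis element \<open>j\<close> is multiplied by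
  the monomial \<open>l - ds ! j\<close>. The definition \<open>homogeneous_vec\<close> goes back from coefficients to elements.
\<close>
definition component :: "'n mon list \<Rightarrow> 'n mon \<Rightarrow> ('n, 'k::field) mpoly vec \<Rightarrow> nat \<Rightarrow> 'k" where
  "component ds l v =
    (\<lambda>j. if j < length ds \<and> lookup (ds ! j) \<le> lookup l then lookup (v $ j) (l - ds ! j) else 0)"

definition homogeneous_vec :: "'n mon list \<Rightarrow> 'n mon \<Rightarrow> (nat \<Rightarrow> 'k::field) \<Rightarrow> ('n, 'k) mpoly vec" where
  "homogeneous_vec ds l c = vec (length ds) (\<lambda>j. Poly_Mapping.single (l - ds ! j) (c j))"

lemma component_in_mstrand: "component ds l v \<in> mstrand ds l"
  unfolding mstrand_def component_def by auto

lemma homogeneous_vec_carrier [simp]: "homogeneous_vec ds l c \<in> carrier_vec (length ds)"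
  unfolding homogeneous_vec_def by simp

lemma component_homogeneous_vec:
  assumes c: "c \<in> mstrand ds l"
  shows "component ds l' (homogeneous_vec ds l c) = (if l' = l then c else 0)"
proof
  fix j
  show "component ds l' (homogeneous_vec ds l c) j = (if l' = l then c else 0) j"
  proof (cases "c j = 0")
    case False
    then have j: "j < length ds" "lookup (ds ! j) \<le> lookup l" using c unfolding mstrand_def by auto
    have "l - ds ! j = l' - ds ! j \<longleftrightarrow> l' = l" if "lookup (ds ! j) \<le> lookup l'"
      using mon_add_diff(1)[OF j(2)] mon_add_diff(1)[OF that] by metis
    then show ?thesis
      using j by (auto simp: component_def homogeneous_vec_def lookup_single when_def)
  qed (auto simp: component_def homogeneous_vec_def)
qed

lemma vec_eq_if_components_eq:
  fixes ds :: "'n mon list"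
  assumes "v \<in> carrier_vec (length ds)" "w \<in> carrier_vec (length ds)"
    and eq: "\<And>l. component ds l v = component ds l w"
  shows "v = w"
proof (rule eq_vecI)
  fix j assume "j < dim_vec w"
  then have j: "j < length ds" using assms(2) by simp
  show "v $ j = w $ j"
  proof (rule poly_mapping_eqI)
    fix b
    show "lookup (v $ j) b = lookup (w $ j) b"
      using fun_cong[OF eq[of "ds ! j + b"], of j] j lookup_le_add(1)[of "ds ! j" b]
      by (simp add: component_def)
  qed
qed (use assms in auto)

lemma finite_components:
  fixes ds :: "'n mon list"
  shows "finite {l. component ds l v \<noteq> 0}"
proof (rule finite_subset)
  show "{l. component ds l v \<noteq> 0} \<subseteq> (\<Union>j<length ds. (\<lambda>b. ds ! j + b) ` keys (v $ j))"
  proof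
    fix l assume "l \<in> {l. component ds l v \<noteq> 0}"
    then obtain j where j: "component ds l v j \<noteq> 0" by (auto simp: fun_eq_iff)
    then have "j < length ds" "lookup (ds ! j) \<le> lookup l" "l - ds ! j \<in> keys (v $ j)"
      by (auto simp: component_def in_keys_iff split: if_splits)
    then show "l \<in> (\<Union>j<length ds. (\<lambda>b. ds ! j + b) ` keys (v $ j))"
      using mon_add_diff(1) by (metis (no_types, lifting) UN_iff image_eqI lessThan_iff)
  qed
qed auto

text \<open>The finiteness hypothesis makes the coordinates of the assembled element polynomials.\<close>
lemma assemble_components:
  fixes ds :: "'n mon list" and w :: "'n mon \<Rightarrow> nat \<Rightarrow> 'k::field"
  assumes w: "\<And>l. w l \<in> mstrand ds l" and fin: "finite {l. w l \<noteq> 0}"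
  obtains v where "v \<in> carrier_vec (length ds)" "\<And>l. component ds l v = w l"
proof -
  define v where "v = vec (length ds) (\<lambda>j. Abs_poly_mapping (\<lambda>b. w (ds ! j + b) j))"
  have look: "lookup (v $ j) b = w (ds ! j + b) j" if j: "j < length ds" for j b
  proof -
    have "(\<lambda>b. ds ! j + b) ` {b. w (ds ! j + b) j \<noteq> 0} \<subseteq> {l. w l \<noteq> 0}" by auto
    then have "finite ((\<lambda>b. ds ! j + b) ` {b. w (ds ! j + b) j \<noteq> 0})"
      using fin by (rule finite_subset)
    then have "finite {b. w (ds ! j + b) j \<noteq> 0}"
      by (rule finite_imageD) (auto simp: inj_on_def)
    then show ?thesis using j unfolding v_def by simp
  qed
  have "component ds l v j = w l j" for l j
  proof (cases "j < length ds \<and> lookup (ds ! j) \<le> lookup l")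
    case True
    then show ?thesis by (simp add: component_def look mon_add_diff(1))
  next
    case False
    then show ?thesis using w[of l] unfolding mstrand_def component_def by auto
  qed
  then have "component ds l v = w l" for l by (rule ext)
  moreover have "v \<in> carrier_vec (length ds)" unfolding v_def by simp
  ultimately show thesis using that by blast
qed

text \<open>
  An inclusion of graded submodules, given by their spaces of components, can be read off in each
  degree: test it on an element concentrated in this degree.
\<close>
lemma subset_if_components_subset:
  assumes V: "\<And>l. V l \<subseteq> mstrand ds l" "\<And>l. 0 \<in> V l"
    and imp: "\<And>v. v \<in> carrier_vec (length ds) \<Longrightarrow> \<forall>l. component ds l v \<in> V l \<Longrightarrow>
      \<forall>l. component ds l v \<in> W l"
  shows "V l \<subseteq> W l"
proof
  fix c assume c: "c \<in> V l"
  then have "component ds l' (homogeneous_vec ds l c) = (if l' = l then c else 0)" for l'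
    using V(1) by (intro component_homogeneous_vec) auto
  then show "c \<in> W l" using imp[of "homogeneous_vec ds l c"] V(2) c by (metis homogeneous_vec_carrier)
qed

definition coeff_mat :: "'n mon list \<Rightarrow> 'n mon list \<Rightarrow> ('n, 'k::field) mpoly mat \<Rightarrow> nat \<Rightarrow> nat \<Rightarrow> 'k" where
  "coeff_mat ds es A i j = lookup (A $$ (i, j)) (es ! j - ds ! i)"

lemma poly_mapping_eq_single: "keys p \<subseteq> {m} \<Longrightarrow> p = Poly_Mapping.single m (lookup p m)"
  by (rule poly_mapping_eqI) (auto simp: lookup_single when_def in_keys_iff)

lemma graded_mat_entry:
  fixes ds es :: "'n mon list"
  assumes A: "graded_mat ds es A" and ij: "i < length ds" "j < length es"
  shows "A $$ (i, j) = Poly_Mapping.single (es ! j - ds ! i) (coeff_mat ds es A i j)"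
    and "coeff_mat ds es A i j \<noteq> 0 \<Longrightarrow> lookup (ds ! i) \<le> lookup (es ! j)"
proof -
  have keys: "a + ds ! i = es ! j" if "a \<in> keys (A $$ (i, j))" for a
    using A ij that unfolding graded_mat_def by blast
  then have "keys (A $$ (i, j)) \<subseteq> {es ! j - ds ! i}"
    by (metis add_diff_cancel_right' singletonI subsetI)
  then show "A $$ (i, j) = Poly_Mapping.single (es ! j - ds ! i) (coeff_mat ds es A i j)"
    unfolding coeff_mat_def by (rule poly_mapping_eq_single)
  assume "coeff_mat ds es A i j \<noteq> 0"
  then have "es ! j - ds ! i \<in> keys (A $$ (i, j))" by (simp add: coeff_mat_def in_keys_iff)
  then show "lookup (ds ! i) \<le> lookup (es ! j)" using keys lookup_le_add(2) by metis
qed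

text \<open>
  A graded matrix has entries \<open>c x^(es ! j - ds ! i)\<close> with scalars \<open>c\<close>, so it preserves degrees and
  acts by the same matrix of scalars in all of them.
\<close>
lemma component_mult:
  fixes ds es :: "'n mon list"
  assumes A: "graded_mat ds es A" and w: "w \<in> carrier_vec (length es)"
  shows "component ds l (A *\<^sub>v w) =
    coeff_map (length ds) (length es) (coeff_mat ds es A) (component es l w)"
proof
  fix i
  show "component ds l (A *\<^sub>v w) i =
    coeff_map (length ds) (length es) (coeff_mat ds es A) (component es l w) i"
  proof (cases "i < length ds")
    case i: True
    have dim: "dim_row A = length ds" "dim_col A = length es" using A unfolding graded_mat_def by auto
    show ?thesis
    proof (cases "lookup (ds ! i) \<le> lookup l")
      case True
      have entry: "lookup (A $$ (i, j) * w $ j) (l - ds ! i) =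
          coeff_mat ds es A i j * component es l w j" if j: "j < length es" for j
      proof (cases "coeff_mat ds es A i j = 0")
        case True
        then show ?thesis using graded_mat_entry(1)[OF A i j] by simp
      next
        case False
        then have le: "lookup (ds ! i) \<le> lookup (es ! j)" by (rule graded_mat_entry(2)[OF A i j])
        have "lookup (es ! j - ds ! i) \<le> lookup (l - ds ! i) \<longleftrightarrow> lookup (es ! j) \<le> lookup l"
        proof -
          have "lookup (es ! j) x - lookup (ds ! i) x \<le> lookup l x - lookup (ds ! i) x \<longleftrightarrow>
              lookup (es ! j) x \<le> lookup l x" for x
            using le_funD[OF le, of x] le_funD[OF True, of x] by arith
          then show ?thesis unfolding le_fun_def lookup_minus by simp
        qed
        moreover have "l - ds ! i - (es ! j - ds ! i) = l - es ! j"
          using le by (intro poly_mapping_eqI) (simp add: lookup_minus le_fun_def)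
        ultimately show ?thesis
          using j by (subst graded_mat_entry(1)[OF A i j]) (simp add: lookup_single_times component_def)
      qed
      have "component ds l (A *\<^sub>v w) i = lookup (\<Sum>j<length es. A $$ (i, j) * w $ j) (l - ds ! i)"
        using i True w dim by (simp add: component_def scalar_prod_def atLeast0LessThan)
      also have "\<dots> = (\<Sum>j<length es. coeff_mat ds es A i j * component es l w j)"
        unfolding lookup_sum by (rule sum.cong) (use entry in auto)
      finally show ?thesis using i by (simp add: coeff_map_def)
    next
      case False
      have "coeff_mat ds es A i j * component es l w j = 0" if j: "j < length es" for j
        using graded_mat_entry(2)[OF A i j] False by (auto simp: component_def dest: order_trans)
      then have "(\<Sum>j<length es. coeff_mat ds es A i j * component es l w j) = 0"
        by (intro sum.neutral) auto
      then show ?thesis using False i by (simp add: component_def[of ds] coeff_map_def)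
    qed
  qed (auto simp: component_def coeff_map_def)
qed

lemma coeff_map_zero [simp]: "coeff_map r s D 0 = 0"
  unfolding coeff_map_def by (auto simp: fun_eq_iff)

lemma coeff_map_in_mstrand:
  fixes ds es :: "'n mon list"
  assumes A: "graded_mat ds es A" and c: "c \<in> mstrand es l"
  shows "coeff_map (length ds) (length es) (coeff_mat ds es A) c \<in> mstrand ds l"
  using component_mult[OF A homogeneous_vec_carrier, of l l c] component_in_mstrand[of ds l]
    component_homogeneous_vec[OF c, of l] by metis

text \<open>
  Membership in the image may be tested degree by degree: preimages of the finitely many nonzero
  components are assembled to a preimage.
\<close>
lemma mat_image_iff:
  fixes ds es :: "'n mon list"
  assumes A: "graded_mat ds es A"
  shows "v \<in> mat_image A \<longleftrightarrow> v \<in> carrier_vec (length ds) \<and>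
    (\<forall>l. component ds l v \<in> coeff_map (length ds) (length es) (coeff_mat ds es A) ` mstrand es l)"
proof -
  have dim: "A \<in> carrier_mat (length ds) (length es)" "dim_col A = length es"
    using A unfolding graded_mat_def by auto
  let ?L = "coeff_map (length ds) (length es) (coeff_mat ds es A)"
  show ?thesis
  proof
    assume "v \<in> mat_image A"
    then obtain w where w: "w \<in> carrier_vec (length es)" "v = A *\<^sub>v w"
      unfolding mat_image_def dim by auto
    then show "v \<in> carrier_vec (length ds) \<and> (\<forall>l. component ds l v \<in> ?L ` mstrand es l)"
      using dim component_in_mstrand component_mult[OF A w(1)] by auto
  next
    assume v: "v \<in> carrier_vec (length ds) \<and> (\<forall>l. component ds l v \<in> ?L ` mstrand es l)"
    \<comment> \<open>Zero components get the preimage zero, so that only finitely many preimages are nonzero.\<close>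
    have "\<exists>c. c \<in> mstrand es l \<and> component ds l v = ?L c \<and> (component ds l v = 0 \<longrightarrow> c = 0)" for l
    proof (cases "component ds l v = 0")
      case True
      then show ?thesis by (intro exI[of _ 0]) (simp add: mstrand_def)
    next
      case False
      then show ?thesis using v by blast
    qed
    then obtain c where c: "\<And>l. c l \<in> mstrand es l" "\<And>l. component ds l v = ?L (c l)"
        "\<And>l. component ds l v = 0 \<Longrightarrow> c l = 0" by metis
    have "finite {l. c l \<noteq> 0}"
      by (rule finite_subset[OF _ finite_components[of ds v]]) (use c(3) in auto)
    then obtain w where w: "w \<in> carrier_vec (length es)" "\<And>l. component es l w = c l"
      using assemble_components[of c es] c(1) by blast
    have "v = A *\<^sub>v w"
    proof (rule vec_eq_if_components_eq)
      show "component ds l v = component ds l (A *\<^sub>v w)" for l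
        by (simp add: component_mult[OF A w(1)] w(2) c(2))
    qed (use v w(1) dim in auto)
    then show "v \<in> mat_image A" using w(1) unfolding mat_image_def dim by auto
  qed
qed

lemma component_zero [simp]: "component ds l (0\<^sub>v (length ds)) = 0"
  by (auto simp: component_def fun_eq_iff)

lemma mat_kernel_iff:
  fixes ds es :: "'n mon list"
  assumes A: "graded_mat ds es A"
  shows "v \<in> mat_kernel A \<longleftrightarrow> v \<in> carrier_vec (length es) \<and>
    (\<forall>l. coeff_map (length ds) (length es) (coeff_mat ds es A) (component es l v) = 0)"
proof -
  have dim: "A \<in> carrier_mat (length ds) (length es)" using A unfolding graded_mat_def by auto
  have "A *\<^sub>v v = 0\<^sub>v (length ds) \<longleftrightarrow>
      (\<forall>l. coeff_map (length ds) (length es) (coeff_mat ds es A) (component es l v) = 0)"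
    if v: "v \<in> carrier_vec (length es)"
  proof -
    have "A *\<^sub>v v = 0\<^sub>v (length ds) \<longleftrightarrow> (\<forall>l. component ds l (A *\<^sub>v v) = component ds l (0\<^sub>v (length ds)))"
      using vec_eq_if_components_eq[of "A *\<^sub>v v" ds "0\<^sub>v (length ds)"] dim v by auto
    then show ?thesis by (simp add: component_mult[OF A v])
  qed
  then show ?thesis unfolding mat_kernel[OF dim] by blast
qed

definition aug_coeff :: "'n mon list \<Rightarrow> ('n, 'k::field) mpoly vec \<Rightarrow> nat \<Rightarrow> 'k" where
  "aug_coeff ds e j = lookup (e $ j) (ds ! j)"

lemma lookup_aug:
  fixes ds :: "'n mon list"
  assumes e: "\<forall>j<length ds. \<forall>a\<in>keys (e $ j). a = ds ! j" and v: "v \<in> carrier_vec (length ds)"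
  shows "lookup (scalar_prod e v) l = (\<Sum>j<length ds. aug_coeff ds e j * component ds l v j)"
proof -
  have "e $ j = Poly_Mapping.single (ds ! j) (aug_coeff ds e j)" if "j < length ds" for j
    unfolding aug_coeff_def by (rule poly_mapping_eq_single) (use e that in auto)
  then have "lookup (e $ j * v $ j) l = aug_coeff ds e j * component ds l v j"
    if "j < length ds" for j
    using that by (simp add: lookup_single_times component_def)
  then show ?thesis
    using v by (simp add: scalar_prod_def lookup_sum atLeast0LessThan)
qed

lemma aug_in_monomial_ideal_iff:
  fixes ds :: "'n::finite mon list"
  assumes M: "monomial_ideal M"
    and e: "\<forall>j<length ds. \<forall>a\<in>keys (e $ j). a = ds ! j" and v: "v \<in> carrier_vec (length ds)"
  shows "scalar_prod e v \<in> M \<longleftrightarrow> (\<forall>l. lookup l \<in> exponents M \<or>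
    (\<Sum>j<length ds. aug_coeff ds e j * component ds l v j) = 0)"
proof -
  have "scalar_prod e v \<in> M \<longleftrightarrow>
      (\<forall>l. lookup l \<in> exponents M \<or> lookup (scalar_prod e v) l = 0)"
    by (subst monomial_ideal_iff[OF M]) (auto simp: in_keys_iff)
  then show ?thesis unfolding lookup_aug[OF e v] .
qed

section \<open>The top Betti number of a minimal resolution\<close>

lemma coefficient_resolution_of_graded:
  fixes M :: "('n::finite, 'k::field) mpoly set"
  assumes M: "monomial_ideal M" and res: "graded_free_resolution M ds e d"
  shows "coefficient_resolution (\<lambda>p. length (ds p)) (\<lambda>p j. lookup (ds p ! j))
    (\<lambda>p. coeff_mat (ds p) (ds (Suc p)) (d p)) (aug_coeff (ds 0) e) (exponents M)"
proof -
  have e: "\<forall>j<length (ds 0). \<forall>a\<in>keys (e $ j). a = ds 0 ! j"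
    and d: "\<And>i. graded_mat (ds i) (ds (Suc i)) (d i)"
    and onto: "\<And>p. \<exists>v\<in>carrier_vec (length (ds 0)). p - scalar_prod e v \<in> M"
    and ex0: "mat_image (d 0) = {v \<in> carrier_vec (length (ds 0)). scalar_prod e v \<in> M}"
    and ex: "\<And>i. mat_image (d (Suc i)) = mat_kernel (d i)"
    using res unfolding graded_free_resolution_def by blast+
  let ?L = "\<lambda>p. coeff_map (length (ds p)) (length (ds (Suc p))) (coeff_mat (ds p) (ds (Suc p)) (d p))"
  let ?aug = "\<lambda>v. \<Sum>j<length (ds 0). aug_coeff (ds 0) e j * v j"
  have im0: "0 \<in> ?L p ` mstrand (ds (Suc p)) l" for p l
    by (rule image_eqI[of _ _ 0]) (auto simp: mstrand_def)
  have im: "?L p ` mstrand (ds (Suc p)) l \<subseteq> mstrand (ds p) l" for p l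
    using coeff_map_in_mstrand[OF d] by blast
  have exact_aug: "?L 0 ` mstrand (ds (Suc 0)) l =
      {v \<in> mstrand (ds 0) l. lookup l \<in> exponents M \<or> ?aug v = 0}" (is "?I l = ?K l") for l
  proof
    have iff: "(\<forall>l. component (ds 0) l v \<in> ?I l) \<longleftrightarrow> (\<forall>l. component (ds 0) l v \<in> ?K l)"
      if v: "v \<in> carrier_vec (length (ds 0))" for v
      using mat_image_iff[OF d[of 0], unfolded ex0, of v] aug_in_monomial_ideal_iff[OF M e v] v
        component_in_mstrand[of "ds 0" _ v] by simp
    show "?I l \<subseteq> ?K l"
      by (rule subset_if_components_subset[of ?I "ds 0", OF im im0]) (use iff in simp)
    show "?K l \<subseteq> ?I l"
      by (rule subset_if_components_subset[of ?K "ds 0"]) (use iff in \<open>auto simp: mstrand_def\<close>)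
  qed
  have exact: "?L (Suc p) ` mstrand (ds (Suc (Suc p))) l = {v \<in> mstrand (ds (Suc p)) l. ?L p v = 0}"
    (is "?I l = ?K l") for p l
  proof
    have iff: "(\<forall>l. component (ds (Suc p)) l v \<in> ?I l) \<longleftrightarrow> (\<forall>l. component (ds (Suc p)) l v \<in> ?K l)"
      if v: "v \<in> carrier_vec (length (ds (Suc p)))" for v
      using mat_image_iff[OF d[of "Suc p"], unfolded ex mat_kernel_iff[OF d], of v] v
        component_in_mstrand[of "ds (Suc p)" _ v] unfolding mem_Collect_eq by blast
    show "?I l \<subseteq> ?K l"
      by (rule subset_if_components_subset[of ?I "ds (Suc p)", OF im im0]) (use iff in simp)
    show "?K l \<subseteq> ?I l"
      by (rule subset_if_components_subset[of ?K "ds (Suc p)"]) (use iff in \<open>auto simp: mstrand_def\<close>)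
  qed
  have aug_onto: "\<exists>v\<in>mstrand (ds 0) l. ?aug v \<noteq> 0" if l: "lookup l \<notin> exponents M" for l
  proof -
    obtain v where v: "v \<in> carrier_vec (length (ds 0))" "mono_of l - scalar_prod e v \<in> M"
      using onto by blast
    then have "l \<notin> keys (mono_of l - scalar_prod e v)"
      using l monomial_ideal_iff[OF M] by blast
    then have "?aug (component (ds 0) l v) = 1"
      by (simp add: in_keys_iff lookup_minus lookup_aug[OF e v(1)] mono_of_def)
    then show ?thesis using component_in_mstrand by (metis zero_neq_one)
  qed
  show ?thesis
  proof (unfold_locales, goal_cases)
    case (1 p i j)
    then show ?case using graded_mat_entry(2)[OF d] by blast
  next
    case (2 a b)
    then show ?case using exponents_up[OF M] by blast
  next
    case (3 l)
    then show ?case using aug_onto[of "Abs_poly_mapping l"] by simp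
  next
    case (4 v l)
    then show ?case using exact_aug[of "Abs_poly_mapping l"] by auto
  next
    case (5 v p l)
    then show ?case using exact[of p "Abs_poly_mapping l"] by auto
  qed
qed

text \<open>A monomial is divisible by a variable unless it is 1.\<close>
lemma max_ideal_iff:
  fixes p :: "('n, 'k::field) mpoly"
  shows "p \<in> max_ideal \<longleftrightarrow> lookup p 0 = 0"
proof -
  let ?X = "\<lambda>x. Poly_Mapping.single x 1 :: 'n mon"
  have max: "max_ideal = (ideal_gen (mono_of ` range ?X) :: ('n, 'k) mpoly set)"
    unfolding max_ideal_def image_image ..
  have "(\<exists>a\<in>range ?X. lookup a \<le> lookup b) \<longleftrightarrow> b \<noteq> 0" for b
  proof
    assume "\<exists>a\<in>range ?X. lookup a \<le> lookup b"
    then obtain x where "lookup (Poly_Mapping.single x 1) x \<le> lookup b x"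
      unfolding le_fun_def by blast
    then show "b \<noteq> 0" by auto
  next
    assume "b \<noteq> 0"
    then obtain x where "lookup b x \<noteq> 0" by (auto simp: poly_mapping_eq_iff fun_eq_iff)
    then have "lookup (Poly_Mapping.single x 1) \<le> lookup b"
      by (auto simp: le_fun_def lookup_single when_def)
    then show "\<exists>a\<in>range ?X. lookup a \<le> lookup b" by blast
  qed
  then have "p \<in> max_ideal \<longleftrightarrow> (\<forall>b\<in>keys p. b \<noteq> 0)"
    unfolding max ideal_gen_mono_iff by blast
  then show ?thesis by (auto simp: in_keys_iff)
qed

text \<open>
  In a minimal resolution a matrix entry between basis elements of the same degree is a constant in
  the maximal ideal, so it is zero; this is the minimality that \<open>rank_top_strand\<close> asks for.
\<close>
theorem count_top_degrees:
  fixes M :: "('n::finite, 'k::field) mpoly set" and l :: "'n mon"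
  assumes M: "monomial_ideal M" and res: "minimal_graded_free_resolution M ds e d"
  shows "count_list (ds CARD('n)) l = (if socle_deg (exponents M) UNIV (lookup l) then 1 else 0)"
proof -
  have gr: "graded_free_resolution M ds e d"
    and min: "\<And>i v j. v \<in> mat_image (d i) \<Longrightarrow> j < length (ds i) \<Longrightarrow> v $ j \<in> max_ideal"
    using res unfolding minimal_graded_free_resolution_def by auto
  have d: "\<And>i. graded_mat (ds i) (ds (Suc i)) (d i)"
    using gr unfolding graded_free_resolution_def by blast
  interpret coefficient_resolution "\<lambda>p. length (ds p)" "\<lambda>p j. lookup (ds p ! j)"
    "\<lambda>p. coeff_mat (ds p) (ds (Suc p)) (d p)" "aug_coeff (ds 0) e" "exponents M"
    by (rule coefficient_resolution_of_graded[OF M gr])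
  have "coeff_mat (ds p) (ds (Suc p)) (d p) i j = 0"
    if ij: "i < length (ds p)" "j < length (ds (Suc p))" "lookup (ds p ! i) = lookup (ds (Suc p) ! j)"
    for p i j
  proof -
    have dp: "d p \<in> carrier_mat (length (ds p)) (length (ds (Suc p)))"
      using d unfolding graded_mat_def by blast
    have "col (d p) j = d p *\<^sub>v unit_vec (length (ds (Suc p))) j"
      using dp ij(2) by (intro eq_vecI) auto
    then have "col (d p) j \<in> mat_image (d p)"
      using dp unfolding mat_image_def by auto
    then have "col (d p) j $ i \<in> max_ideal" using min ij(1) by blast
    then have "lookup (d p $$ (i, j)) 0 = 0" using dp ij by (simp add: max_ideal_iff)
    then show ?thesis using ij(3) by (simp add: coeff_mat_def poly_mapping.lookup_inject)
  qed
  then have "card {j. j < length (ds CARD('n)) \<and> lookup (ds CARD('n) ! j) = lookup l} =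
      (if socle_deg (exponents M) UNIV (lookup l) then 1 else 0)"
    by (intro rank_top_strand) auto
  moreover have "count_list xs l = card {j. j < length xs \<and> lookup (xs ! j) = lookup l}" for xs
    by (simp add: count_list_eq_length_filter length_filter_conv_card lookup_inject eq_commute)
  ultimately show ?thesis by simp
qed

section \<open>Existence of minimal resolutions\<close>

text \<open>
  To pass from \<open>X\<close> to \<open>insert y X\<close>, let \<open>N\<close> bound the exponents in \<open>y\<close> of a finite set \<open>F\<close> that works for
  \<open>X\<close>. Elements of \<open>U\<close> with exponent at least \<open>N\<close> in \<open>y\<close> are covered by \<open>F\<close>; those with a smaller
  exponent \<open>k\<close> are covered by applying the induction hypothesis to the elements with exponent \<open>k\<close>.
\<close>
lemma dickson_on:
  fixes U :: "('n \<Rightarrow> nat) set"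
  assumes "finite X"
  shows "\<exists>F\<subseteq>U. finite F \<and> (\<forall>u\<in>U. \<exists>f\<in>F. \<forall>x\<in>X. f x \<le> u x)"
  using assms
proof (induction X arbitrary: U rule: finite_induct)
  case empty
  show ?case
  proof (cases "U = {}")
    case False
    then obtain u where "u \<in> U" by auto
    then show ?thesis by (intro exI[of _ "{u}"]) auto
  qed auto
next
  case (insert y X)
  obtain F where F: "F \<subseteq> U" "finite F" "\<And>u. u \<in> U \<Longrightarrow> \<exists>f\<in>F. \<forall>x\<in>X. f x \<le> u x"
    using insert.IH[of U] by blast
  obtain N where N: "\<And>f. f \<in> F \<Longrightarrow> f y \<le> N"
    using finite_imageI[OF F(2), of "\<lambda>f. f y"] by (meson Max_ge imageI)
  have "\<exists>E\<subseteq>{u \<in> U. u y = k}. finite E \<and> (\<forall>u\<in>{u \<in> U. u y = k}. \<exists>f\<in>E. \<forall>x\<in>X. f x \<le> u x)" for k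
    by (rule insert.IH)
  then obtain E where E0: "\<forall>k. E k \<subseteq> {u \<in> U. u y = k} \<and> finite (E k) \<and>
      (\<forall>u\<in>{u \<in> U. u y = k}. \<exists>f\<in>E k. \<forall>x\<in>X. f x \<le> u x)"
    using choice[of "\<lambda>k E. E \<subseteq> {u \<in> U. u y = k} \<and> finite E \<and>
      (\<forall>u\<in>{u \<in> U. u y = k}. \<exists>f\<in>E. \<forall>x\<in>X. f x \<le> u x)"] by blast
  have E: "E k \<subseteq> {u \<in> U. u y = k}" "finite (E k)"
    "u \<in> U \<Longrightarrow> u y = k \<Longrightarrow> \<exists>f\<in>E k. \<forall>x\<in>X. f x \<le> u x" for k u
    using E0[rule_format, of k] by auto
  have "\<exists>f\<in>F \<union> (\<Union>k<N. E k). \<forall>x\<in>insert y X. f x \<le> u x" if u: "u \<in> U" for u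
  proof (cases "u y < N")
    case True
    obtain f where f: "f \<in> E (u y)" "\<forall>x\<in>X. f x \<le> u x" using E(3)[OF u refl] by blast
    moreover have "f y \<le> u y" using E(1)[of "u y"] f(1) by auto
    ultimately show ?thesis using True by (intro bexI[of _ f]) auto
  next
    case False
    obtain f where f: "f \<in> F" "\<forall>x\<in>X. f x \<le> u x" using F(3)[OF u] by blast
    moreover have "f y \<le> u y" using N[OF f(1)] False by simp
    ultimately show ?thesis by (intro bexI[of _ f]) auto
  qed
  moreover have "F \<union> (\<Union>k<N. E k) \<subseteq> U" "finite (F \<union> (\<Union>k<N. E k))"
    using F(1,2) E(1,2) by blast+
  ultimately show ?case by blast
qed

lemma dickson:
  fixes U :: "'n::finite mon set"
  obtains F where "F \<subseteq> U" "finite F" "\<And>u. u \<in> U \<Longrightarrow> \<exists>f\<in>F. lookup f \<le> lookup u"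
proof -
  obtain F where F: "F \<subseteq> lookup ` U" "finite F" "\<And>u. u \<in> lookup ` U \<Longrightarrow> \<exists>f\<in>F. \<forall>x. f x \<le> u x"
    using dickson_on[of "UNIV :: 'n set" "lookup ` U"] by auto
  obtain F' where "F' \<subseteq> U" "finite F'" "F = lookup ` F'"
    using finite_subset_image[OF F(2,1)] by blast
  then show thesis using that[of F'] F(3) by (auto simp: le_fun_def)
qed

definition scale_fun :: "'k::field \<Rightarrow> (nat \<Rightarrow> 'k) \<Rightarrow> nat \<Rightarrow> 'k" where
  "scale_fun c v = (\<lambda>i. c * v i)"

interpretation fun_space: vector_space scale_fun
  by standard (auto simp: scale_fun_def fun_eq_iff algebra_simps)

text \<open>
  The components of a graded submodule of a graded free module form such a family: multiplication by
  monomials does not change coefficient vectors, so closure under it is monotonicity.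
\<close>
definition monotone_family :: "('n mon \<Rightarrow> (nat \<Rightarrow> 'k::field) set) \<Rightarrow> bool" where
  "monotone_family V \<longleftrightarrow> (\<forall>l. fun_space.subspace (V l)) \<and>
    (\<forall>a b. lookup a \<le> lookup b \<longrightarrow> V a \<subseteq> V b)"

text \<open>A pair stands for the homogeneous generator with the given degree and coefficients.\<close>
definition generates :: "('n mon \<times> (nat \<Rightarrow> 'k::field)) set \<Rightarrow> ('n mon \<Rightarrow> (nat \<Rightarrow> 'k) set) \<Rightarrow> bool" where
  "generates G V \<longleftrightarrow> finite G \<and> (\<forall>g\<in>G. snd g \<in> V (fst g)) \<and>
    (\<forall>l. V l \<subseteq> fun_space.span (snd ` {g \<in> G. lookup (fst g) \<le> lookup l}))"

text \<open>
  Induction on the rank, as for submodules of finite free modules over a Noetherian ring: the degrees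
  in which some vector has nonzero last coordinate form a monomial ideal, which has finitely many
  generators by Dickson's lemma; a vector for each of them, together with generators of the family of
  vectors with last coordinate zero, generates.
\<close>
lemma finitely_generated:
  fixes V :: "'n::finite mon \<Rightarrow> (nat \<Rightarrow> 'k::field) set"
  assumes "monotone_family V" "\<And>l c j. c \<in> V l \<Longrightarrow> j \<ge> r \<Longrightarrow> c j = 0"
  shows "\<exists>G. generates G V"
  using assms
proof (induction r arbitrary: V)
  case 0
  have "V l \<subseteq> {0}" for l using "0.prems"(2) by (auto simp: fun_eq_iff)
  then have "generates {} V" unfolding generates_def by auto
  then show ?case ..
next
  case (Suc r)
  have sub: "fun_space.subspace (V l)" for l using Suc.prems(1) unfolding monotone_family_def by blast
  have mono: "V a \<subseteq> V b" if "lookup a \<le> lookup b" for a b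
    using Suc.prems(1) that unfolding monotone_family_def by blast
  obtain F where F: "F \<subseteq> {a. \<exists>c\<in>V a. c r \<noteq> 0}" "finite F"
      "\<And>u. u \<in> {a. \<exists>c\<in>V a. c r \<noteq> 0} \<Longrightarrow> \<exists>f\<in>F. lookup f \<le> lookup u" by (rule dickson) blast
  have "\<forall>a\<in>F. \<exists>c. c \<in> V a \<and> c r \<noteq> 0" using F(1) by blast
  then obtain g where g: "\<And>a. a \<in> F \<Longrightarrow> g a \<in> V a \<and> g a r \<noteq> 0"
    using bchoice[of F "\<lambda>a c. c \<in> V a \<and> c r \<noteq> 0"] by blast
  define V' where "V' = (\<lambda>l. {c \<in> V l. c r = 0})"
  have "monotone_family V'"
    unfolding monotone_family_def
  proof (intro conjI allI impI)
    show "fun_space.subspace (V' l)" for l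
      using sub[of l] unfolding fun_space.subspace_def V'_def by (auto simp: scale_fun_def)
    show "V' a \<subseteq> V' b" if "lookup a \<le> lookup b" for a b
      using mono[OF that] unfolding V'_def by blast
  qed
  moreover have "c j = 0" if "c \<in> V' l" "j \<ge> r" for l c j
    using that Suc.prems(2)[of c l j] unfolding V'_def by (cases "j = r") auto
  ultimately obtain G' where G': "generates G' V'" using Suc.IH by blast
  define G where "G = G' \<union> (\<lambda>a. (a, g a)) ` F"
  have "c \<in> fun_space.span (snd ` {g \<in> G. lookup (fst g) \<le> lookup l})" (is "_ \<in> fun_space.span ?S")
    if c: "c \<in> V l" for l c
  proof -
    have V'S: "V' l \<subseteq> fun_space.span ?S"
    proof -
      have "V' l \<subseteq> fun_space.span (snd ` {g \<in> G'. lookup (fst g) \<le> lookup l})"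
        using G' unfolding generates_def by blast
      also have "\<dots> \<subseteq> fun_space.span ?S" by (intro fun_space.span_mono image_mono) (auto simp: G_def)
      finally show ?thesis .
    qed
    show ?thesis
    proof (cases "c r = 0")
      case True
      then show ?thesis using c V'S unfolding V'_def by blast
    next
      case False
      then obtain a where a: "a \<in> F" "lookup a \<le> lookup l" using F(3)[of l] c by blast
      define k where "k = c r / g a r"
      have gl: "g a \<in> V l" using g[OF a(1)] mono[OF a(2)] by blast
      have "c - scale_fun k (g a) \<in> V l"
        by (intro fun_space.subspace_diff fun_space.subspace_scale sub c gl)
      moreover have "(c - scale_fun k (g a)) r = 0"
        using g[OF a(1)] by (simp add: scale_fun_def k_def)
      ultimately have 1: "c - scale_fun k (g a) \<in> fun_space.span ?S" using V'S unfolding V'_def by blast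
      have "(a, g a) \<in> {g \<in> G. lookup (fst g) \<le> lookup l}" using a by (auto simp: G_def)
      then have "snd (a, g a) \<in> ?S" by (rule imageI)
      then have "scale_fun k (g a) \<in> fun_space.span ?S"
        by (intro fun_space.span_scale fun_space.span_base) simp
      from fun_space.span_add[OF 1 this] show ?thesis by simp
    qed
  qed
  moreover have "finite G" "\<forall>g\<in>G. snd g \<in> V (fst g)"
    using G' F(2) g unfolding generates_def G_def V'_def by auto
  ultimately have "generates G V" unfolding generates_def by blast
  then show ?case ..
qed

lemma generates_without_redundant:
  assumes G: "generates G V" and g: "g \<in> G"
    and red: "snd g \<in> fun_space.span (snd ` {h \<in> G - {g}. lookup (fst h) \<le> lookup (fst g)})"
  shows "generates (G - {g}) V"
proof -
  have "fun_space.span (snd ` {h \<in> G. lookup (fst h) \<le> lookup l}) \<subseteq>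
      fun_space.span (snd ` {h \<in> G - {g}. lookup (fst h) \<le> lookup l})" (is "_ \<subseteq> ?S") for l
  proof (rule fun_space.span_minimal)
    show "snd ` {h \<in> G. lookup (fst h) \<le> lookup l} \<subseteq> ?S"
    proof
      fix c assume "c \<in> snd ` {h \<in> G. lookup (fst h) \<le> lookup l}"
      then obtain h where h: "h \<in> G" "lookup (fst h) \<le> lookup l" "c = snd h" by auto
      show "c \<in> ?S"
      proof (cases "h = g")
        case True
        have "snd ` {h \<in> G - {g}. lookup (fst h) \<le> lookup (fst g)} \<subseteq>
            snd ` {h \<in> G - {g}. lookup (fst h) \<le> lookup l}"
          using h(2) unfolding True by (auto intro: order_trans)
        then show ?thesis using red fun_space.span_mono unfolding h(3) True by blast
      next
        case False
        then show ?thesis using h by (intro fun_space.span_base) auto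
      qed
    qed
  qed (rule fun_space.subspace_span)
  then show ?thesis using G unfolding generates_def by blast
qed

lemma sum_apply: "(\<Sum>a\<in>A. f a) i = (\<Sum>a\<in>A. f a i)"
  for f :: "'a \<Rightarrow> 'b \<Rightarrow> 'c::comm_monoid_add"
  by (induction A rule: infinite_finite_induct) auto

lemma coeff_map_add: "coeff_map r s D (v + w) = coeff_map r s D v + coeff_map r s D w"
  unfolding coeff_map_def by (auto simp: fun_eq_iff distrib_left sum.distrib)

lemma coeff_map_scale: "coeff_map r s D (scale_fun c v) = scale_fun c (coeff_map r s D v)"
  unfolding coeff_map_def scale_fun_def by (auto simp: fun_eq_iff sum_distrib_left intro!: sum.cong)

lemma subspace_mstrand: "fun_space.subspace (mstrand ds l)"
  unfolding fun_space.subspace_def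
proof (intro conjI ballI allI)
  show "x + y \<in> mstrand ds l" if "x \<in> mstrand ds l" "y \<in> mstrand ds l" for x y :: "nat \<Rightarrow> 'a"
  proof -
    have "x j \<noteq> 0 \<or> y j \<noteq> 0" if "(x + y) j \<noteq> 0" for j using that by auto
    then show ?thesis using that unfolding mstrand_def by blast
  qed
qed (auto simp: mstrand_def scale_fun_def)

lemma mstrand_mono: "lookup a \<le> lookup b \<Longrightarrow> mstrand ds a \<subseteq> mstrand ds b"
  unfolding mstrand_def by (auto intro: order_trans)

text \<open>
  Take a generating set with the least number of elements. In a relation between the generators, a
  coefficient with nonzero constant term would express a generator by the others, which then generate
  as well. So all relations have coefficients in the maximal ideal.
\<close>
lemma minimal_cover:
  fixes V :: "'n::finite mon \<Rightarrow> (nat \<Rightarrow> 'k::field) set"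
  assumes V: "monotone_family V" and sub: "\<And>l. V l \<subseteq> mstrand ds l"
  shows "\<exists>es A. graded_mat ds es A \<and>
    mat_image A = {v \<in> carrier_vec (length ds). \<forall>l. component ds l v \<in> V l} \<and>
    (\<forall>v\<in>mat_kernel A. \<forall>j<length es. v $ j \<in> max_ideal)"
proof -
  have subV: "fun_space.subspace (V l)" for l using V unfolding monotone_family_def by blast
  have "\<exists>G. generates G V"
    by (rule finitely_generated[OF V, of "length ds"]) (use sub in \<open>force simp: mstrand_def\<close>)
  then obtain G where G: "generates G V" "\<And>H. generates H V \<Longrightarrow> card G \<le> card H"
    using ex_has_least_nat[of "\<lambda>G. generates G V" _ card] by blast
  have "finite G" using G(1) unfolding generates_def by blast
  then obtain gs where gs: "set gs = G" "distinct gs" using finite_distinct_list[of G] by blast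
  define es where "es = map fst gs"
  define D where "D = (\<lambda>i j. snd (gs ! j) i)"
  define A where "A = mat (length ds) (length es)
    (\<lambda>(i, j). Poly_Mapping.single (es ! j - ds ! i) (D i j))"
  have es: "es ! j = fst (gs ! j)" if "j < length gs" for j
    using that unfolding es_def by auto
  have leng: "length es = length gs" unfolding es_def by simp
  have gsG: "gs ! j \<in> G" if "j < length gs" for j using gs(1) that by auto
  have gV: "snd g \<in> V (fst g)" if "g \<in> G" for g using G(1) that unfolding generates_def by blast
  have D_le: "i < length ds \<and> lookup (ds ! i) \<le> lookup (es ! j)" if "j < length gs" "D i j \<noteq> 0" for i j
    using gV[OF gsG[OF that(1)]] sub that unfolding D_def es[OF that(1)] mstrand_def by blast
  have A: "graded_mat ds es A"
    unfolding graded_mat_def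
  proof (intro conjI allI impI ballI)
    show "A \<in> carrier_mat (length ds) (length es)" unfolding A_def by simp
    fix i j a assume ij: "i < length ds" "j < length es" and a: "a \<in> keys (A $$ (i, j))"
    then have "a = es ! j - ds ! i" "D i j \<noteq> 0"
      by (auto simp: A_def split: if_splits)
    then show "a + ds ! i = es ! j" using D_le ij leng by (metis mon_add_diff(2))
  qed
  define L where "L = coeff_map (length ds) (length es) D"
  have L: "coeff_map (length ds) (length es) (coeff_mat ds es A) = L"
    unfolding L_def coeff_map_def coeff_mat_def by (auto simp: fun_eq_iff A_def intro!: sum.cong)
  have L_sum: "L c = (\<Sum>j<length gs. scale_fun (c j) (snd (gs ! j)))" for c
  proof
    fix i
    have "L c i = (\<Sum>j<length gs. c j * snd (gs ! j) i)"
    proof (cases "i < length ds")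
      case True
      then show ?thesis by (simp add: L_def coeff_map_def leng D_def mult.commute)
    next
      case False
      then have "snd (gs ! j) i = 0" if "j < length gs" for j
        using D_le[OF that] unfolding D_def by blast
      then show ?thesis using False by (simp add: L_def coeff_map_def)
    qed
    also have "\<dots> = (\<Sum>j<length gs. scale_fun (c j) (snd (gs ! j))) i"
      by (simp add: sum_apply scale_fun_def)
    finally show "L c i = (\<Sum>j<length gs. scale_fun (c j) (snd (gs ! j))) i" .
  qed
  have image: "L ` mstrand es l = V l" for l
  proof
    show "L ` mstrand es l \<subseteq> V l"
    proof
      fix v assume "v \<in> L ` mstrand es l"
      then obtain c where c: "c \<in> mstrand es l" "v = L c" by auto
      have "scale_fun (c j) (snd (gs ! j)) \<in> V l" if j: "j < length gs" for j
      proof (cases "c j = 0")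
        case True
        then show ?thesis using fun_space.subspace_0[OF subV, of l] by simp
      next
        case False
        then have "lookup (fst (gs ! j)) \<le> lookup l" using c(1) es[OF j] unfolding mstrand_def by auto
        then have "snd (gs ! j) \<in> V l"
          using gV[OF gsG[OF j]] V unfolding monotone_family_def by blast
        then show ?thesis by (rule fun_space.subspace_scale[OF subV])
      qed
      then show "v \<in> V l" unfolding c(2) L_sum by (intro fun_space.subspace_sum[OF subV]) auto
    qed
    have "V l \<subseteq> fun_space.span (snd ` {g \<in> G. lookup (fst g) \<le> lookup l})"
      using G(1) unfolding generates_def by blast
    also have "\<dots> \<subseteq> L ` mstrand es l"
    proof (rule fun_space.span_minimal)
      show "snd ` {g \<in> G. lookup (fst g) \<le> lookup l} \<subseteq> L ` mstrand es l"
      proof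
        fix c assume "c \<in> snd ` {g \<in> G. lookup (fst g) \<le> lookup l}"
        then obtain j where j: "j < length gs" "lookup (fst (gs ! j)) \<le> lookup l" "c = snd (gs ! j)"
          using gs(1) by (auto simp: in_set_conv_nth)
        define u where "u = (\<lambda>i. if i = j then 1 else 0 :: 'k)"
        have "L u = (\<Sum>i<length gs. if i = j then snd (gs ! j) else 0)"
          unfolding L_sum by (rule sum.cong) (auto simp: u_def scale_fun_def)
        then have "L u = c" using j by simp
        moreover have "u \<in> mstrand es l" using j leng es unfolding mstrand_def u_def by auto
        ultimately show "c \<in> L ` mstrand es l" by blast
      qed
      show "fun_space.subspace (L ` mstrand es l)"
        unfolding fun_space.subspace_def
      proof (intro conjI ballI allI)
        show "0 \<in> L ` mstrand es l"
          by (rule image_eqI[of _ _ 0]) (auto simp: L_def fun_space.subspace_0[OF subspace_mstrand])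
        fix x assume "x \<in> L ` mstrand es l"
        then obtain v where v: "v \<in> mstrand es l" "x = L v" by blast
        show "scale_fun c x \<in> L ` mstrand es l" for c
          using fun_space.subspace_scale[OF subspace_mstrand v(1)]
          unfolding v(2) L_def coeff_map_scale[symmetric] by (rule imageI)
        fix y assume "y \<in> L ` mstrand es l"
        then obtain w where w: "w \<in> mstrand es l" "y = L w" by blast
        show "x + y \<in> L ` mstrand es l"
          using fun_space.subspace_add[OF subspace_mstrand v(1) w(1)]
          unfolding v(2) w(2) L_def coeff_map_add[symmetric] by (rule imageI)
      qed
    qed
    finally show "V l \<subseteq> L ` mstrand es l" .
  qed
  have minimal: "c j = 0" if c: "c \<in> mstrand es (es ! j)" "L c = 0" and j: "j < length gs" for c j
  proof (rule ccontr)
    assume cj: "c j \<noteq> 0"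
    define g where "g = gs ! j"
    have gG: "g \<in> G" using gsG[OF j] unfolding g_def .
    let ?S = "fun_space.span (snd ` {h \<in> G - {g}. lookup (fst h) \<le> lookup (fst g)})"
    have "scale_fun (c i) (snd (gs ! i)) \<in> ?S" if i: "i < length gs" "i \<noteq> j" for i
    proof (cases "c i = 0")
      case True
      then show ?thesis using fun_space.span_zero by simp
    next
      case False
      then have "lookup (fst (gs ! i)) \<le> lookup (fst g)"
        using c(1) es i j unfolding mstrand_def g_def by auto
      moreover have "gs ! i \<noteq> g" using gs(2) i j unfolding g_def by (simp add: nth_eq_iff_index_eq)
      ultimately show ?thesis
        using gsG[OF i(1)] by (intro fun_space.span_scale fun_space.span_base) auto
    qed
    then have S: "(\<Sum>i\<in>{..<length gs} - {j}. scale_fun (c i) (snd (gs ! i))) \<in> ?S" (is "?s \<in> _")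
      by (intro fun_space.span_sum) auto
    have "scale_fun (c j) (snd g) + ?s = 0"
      using c(2) j unfolding L_sum g_def by (subst (asm) sum.remove[of _ j]) auto
    then have "scale_fun (c j) (snd g) = - ?s" by (rule eq_neg_iff_add_eq_0[THEN iffD2])
    then have "scale_fun (1 / c j) (scale_fun (c j) (snd g)) \<in> ?S"
      using S by (simp only: fun_space.span_scale fun_space.span_neg)
    then have "snd g \<in> ?S" using cj by simp
    then have "generates (G - {g}) V" by (rule generates_without_redundant[OF G(1) gG])
    then have "card G \<le> card (G - {g})" by (rule G(2))
    moreover have "card (G - {g}) < card G"
      using G(1) gG unfolding generates_def by (meson card_Diff1_less)
    ultimately show False by simp
  qed
  have "v $ j \<in> max_ideal" if v: "v \<in> mat_kernel A" and j: "j < length es" for v j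
  proof -
    have "component es (es ! j) v j = 0"
    proof (rule minimal[OF component_in_mstrand])
      show "L (component es (es ! j) v) = 0" using v unfolding mat_kernel_iff[OF A] L by blast
    qed (use j leng in simp)
    then show ?thesis using j by (simp add: component_def max_ideal_iff)
  qed
  moreover have "mat_image A = {v \<in> carrier_vec (length ds). \<forall>l. component ds l v \<in> V l}"
    using mat_image_iff[OF A] unfolding L image by blast
  ultimately show ?thesis using A by blast
qed

lemma monotone_family_kernel:
  "monotone_family (\<lambda>l. {c \<in> mstrand ds l. coeff_map r s D c = 0})"
  unfolding monotone_family_def
proof (intro conjI allI impI)
  show "fun_space.subspace {c \<in> mstrand ds l. coeff_map r s D c = 0}" for l
    using subspace_mstrand[of ds l] unfolding fun_space.subspace_def by (auto simp: coeff_map_add coeff_map_scale)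
  show "{c \<in> mstrand ds a. coeff_map r s D c = 0} \<subseteq> {c \<in> mstrand ds b. coeff_map r s D c = 0}"
    if "lookup a \<le> lookup b" for a b
    using mstrand_mono[OF that] by blast
qed

lemma minimal_cover_kernel:
  fixes ds es :: "'n::finite mon list" and A :: "('n, 'k::field) mpoly mat"
  assumes A: "graded_mat ds es A"
  shows "\<exists>fs B. graded_mat es fs B \<and> mat_image B = mat_kernel A \<and>
    (\<forall>v\<in>mat_kernel B. \<forall>j<length fs. v $ j \<in> max_ideal)"
proof -
  let ?V = "\<lambda>l. {c \<in> mstrand es l. coeff_map (length ds) (length es) (coeff_mat ds es A) c = 0}"
  have "mat_kernel A = {v \<in> carrier_vec (length es). \<forall>l. component es l v \<in> ?V l}"
    using mat_kernel_iff[OF A] component_in_mstrand by blast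
  then show ?thesis using minimal_cover[of ?V es, OF monotone_family_kernel] by auto
qed

lemma monotone_family_aug:
  fixes M :: "('n::finite, 'k::field) mpoly set"
  assumes M: "monomial_ideal M"
  shows "monotone_family (\<lambda>l. {c \<in> mstrand ds l. lookup l \<in> exponents M \<or>
    (\<Sum>j<r. f j * c j) = (0::'k)})"
  unfolding monotone_family_def
proof (intro conjI allI impI)
  show "fun_space.subspace {c \<in> mstrand ds l. lookup l \<in> exponents M \<or> (\<Sum>j<r. f j * c j) = 0}" for l
  proof -
    have "(\<Sum>j<r. f j * (k * c j)) = k * (\<Sum>j<r. f j * c j)" for k c
      by (simp add: sum_distrib_left algebra_simps)
    then show ?thesis
      using subspace_mstrand[of ds l] unfolding fun_space.subspace_def
      by (auto simp: scale_fun_def distrib_left sum.distrib)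
  qed
  show "{c \<in> mstrand ds a. lookup a \<in> exponents M \<or> (\<Sum>j<r. f j * c j) = 0} \<subseteq>
      {c \<in> mstrand ds b. lookup b \<in> exponents M \<or> (\<Sum>j<r. f j * c j) = 0}"
    if "lookup a \<le> lookup b" for a b
    using mstrand_mono[OF that] exponents_up[OF M _ that] by blast
qed

text \<open>
  The free module in homological degree 0 is \<open>S\<close> with basis 1, or \<open>0\<close> if \<open>M = S\<close>. In both cases the
  kernel of the augmentation lies in the maximal ideal times the module. Each further map is a
  minimal cover of the kernel of the preceding one, and the minimality of a cover bounds the image of
  the next.
\<close>
theorem minimal_resolution_exists:
  fixes M :: "('n::finite, 'k::field) mpoly set"
  assumes M: "monomial_ideal M"
  shows "\<exists>ds e d. minimal_graded_free_resolution M ds e d"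
proof -
  obtain d0 :: "'n mon list" and e :: "('n, 'k) mpoly vec" where
    e: "e \<in> carrier_vec (length d0)" "\<forall>j<length d0. \<forall>a\<in>keys (e $ j). a = d0 ! j"
    and onto: "\<And>p. \<exists>v\<in>carrier_vec (length d0). p - scalar_prod e v \<in> M"
    and min: "\<And>v j. v \<in> carrier_vec (length d0) \<Longrightarrow> scalar_prod e v \<in> M \<Longrightarrow> j < length d0 \<Longrightarrow>
      v $ j \<in> max_ideal"
  proof (cases "mono_of 0 \<in> M")
    case True
    have "lookup 0 \<in> exponents M" using True unfolding lookup_in_exponents .
    then have "lookup b \<in> exponents M" for b
      by (rule exponents_up[OF M]) (simp add: le_fun_def)
    then have "p \<in> M" for p by (subst monomial_ideal_iff[OF M]) blast
    then show thesis by (intro that[of "0\<^sub>v 0" "[]"]) (auto intro: zero_carrier_vec)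
  next
    case False
    define e :: "('n, 'k) mpoly vec" where "e = vec 1 (\<lambda>_. 1)"
    have sp: "scalar_prod e v = v $ 0" if "v \<in> carrier_vec 1" for v
      using that by (simp add: e_def scalar_prod_def)
    have "v $ 0 \<in> max_ideal" if "v $ 0 \<in> M" for v
    proof -
      have "0 \<notin> keys (v $ 0)"
        using that False monomial_ideal_iff[OF M, of "v $ 0"] lookup_in_exponents by blast
      then show ?thesis by (simp add: max_ideal_iff in_keys_iff)
    qed
    moreover have "\<exists>v\<in>carrier_vec 1. p - scalar_prod e v \<in> M" for p
    proof -
      have "p - scalar_prod e (vec 1 (\<lambda>_. p)) \<in> M"
        by (subst monomial_ideal_iff[OF M]) (simp add: sp)
      then show ?thesis by (meson vec_carrier)
    qed
    ultimately show thesis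
      by (intro that[of e "[0]"]) (auto simp: sp e_def[symmetric], auto simp: e_def)
  qed
  define good where "good = (\<lambda>(ds, es, A :: ('n, 'k) mpoly mat). graded_mat ds es A \<and>
    (\<forall>v\<in>mat_kernel A. \<forall>j<length es. v $ j \<in> max_ideal))"
  define K0 where "K0 = {v \<in> carrier_vec (length d0). scalar_prod e v \<in> M}"
  let ?V = "\<lambda>l. {c \<in> mstrand d0 l. lookup l \<in> exponents M \<or>
    (\<Sum>j<length d0. aug_coeff d0 e j * c j) = 0}"
  have K0: "K0 = {v \<in> carrier_vec (length d0). \<forall>l. component d0 l v \<in> ?V l}"
    unfolding K0_def using aug_in_monomial_ideal_iff[OF M e(2)] component_in_mstrand[of d0] by blast
  have "\<exists>f. \<forall>n. (good (f n) \<and> (n = 0 \<longrightarrow> fst (f n) = d0 \<and> mat_image (snd (snd (f n))) = K0)) \<and>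
    (fst (f (Suc n)) = fst (snd (f n)) \<and>
      mat_image (snd (snd (f (Suc n)))) = mat_kernel (snd (snd (f n))))"
  proof (rule dependent_nat_choice[where
        P = "\<lambda>n x. good x \<and> (n = 0 \<longrightarrow> fst x = d0 \<and> mat_image (snd (snd x)) = K0)" and
        Q = "\<lambda>n x y. fst y = fst (snd x) \<and> mat_image (snd (snd y)) = mat_kernel (snd (snd x))"],
      goal_cases)
    case 1
    have "\<exists>es A. graded_mat d0 es A \<and> mat_image A = K0 \<and>
        (\<forall>v\<in>mat_kernel A. \<forall>j<length es. v $ j \<in> max_ideal)"
      unfolding K0 by (rule minimal_cover[OF monotone_family_aug[OF M]]) auto
    then show ?case unfolding good_def by auto
  next
    case (2 x n)
    obtain ds es A where x: "x = (ds, es, A)" by (cases x)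
    have "graded_mat ds es A" using 2 unfolding x good_def by simp
    from minimal_cover_kernel[OF this] show ?case unfolding x good_def by auto
  qed
  then obtain f where f: "\<And>n. good (f n)" "fst (f 0) = d0" "mat_image (snd (snd (f 0))) = K0"
      "\<And>n. fst (f (Suc n)) = fst (snd (f n))"
      "\<And>n. mat_image (snd (snd (f (Suc n)))) = mat_kernel (snd (snd (f n)))" by metis
  define ds where "ds = (\<lambda>n. fst (f n))"
  define d where "d = (\<lambda>n. snd (snd (f n)))"
  have fn: "f n = (ds n, ds (Suc n), d n)" for n unfolding ds_def d_def by (simp add: f(4))
  have gr: "graded_mat (ds n) (ds (Suc n)) (d n)"
    and ker: "v \<in> mat_kernel (d n) \<Longrightarrow> j < length (ds (Suc n)) \<Longrightarrow> v $ j \<in> max_ideal" for n v j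
    using f(1)[of n] unfolding fn good_def by auto
  have ds0: "ds 0 = d0" "mat_image (d 0) = K0" using f(2,3) unfolding ds_def d_def by auto
  have ex: "mat_image (d (Suc n)) = mat_kernel (d n)" for n using f(5) unfolding d_def by simp
  have "graded_free_resolution M ds e d"
    unfolding graded_free_resolution_def ds0 using e gr onto ex K0_def by blast
  moreover have "v $ j \<in> max_ideal" if "v \<in> mat_image (d n)" "j < length (ds n)" for n v j
  proof (cases n)
    case 0
    then show ?thesis using that min unfolding 0 ds0 K0_def by blast
  next
    case (Suc n')
    then show ?thesis using that ker unfolding Suc ex by blast
  qed
  ultimately show ?thesis unfolding minimal_graded_free_resolution_def by blast
qed

theorem corollary6p2:
  fixes M :: "('n::finite, 'k::field) mpoly set" and l :: "'n mon"
  assumes "monomial_ideal M"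
  shows "betti M CARD('n) l = (if \<exists>D\<in>dominant_family M. l = lcm_mon D then 1 else 0)"
proof -
  let ?b = "if socle_deg (exponents M) UNIV (lookup l) then 1 else 0 :: nat"
  obtain ds e d where "minimal_graded_free_resolution M ds e d"
    using minimal_resolution_exists[OF assms] by blast
  \<comment> \<open>The count is the same for every minimal resolution, so the existence of one suffices.\<close>
  then have "betti M CARD('n) l = ?b"
    unfolding betti_def
    by (intro the_equality exI[of _ ds] exI[of _ e] exI[of _ d])
      (auto simp: count_top_degrees[OF assms])
  also have "socle_deg (exponents M) UNIV (lookup l) \<longleftrightarrow> (\<exists>D\<in>dominant_family M. l = lcm_mon D)"
    using socle_deg_if_dominant_family[OF assms] dominant_family_if_socle_deg[OF assms] by metis
  finally show ?thesis .
qed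

end
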